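(* Let $(X,T)$ be a uniquely ergodic topological dynamical system with invariant measure $\mu$, and suppose $E_0(T)=G_0(T)$. Let $f\in C(X)$ and $\alpha\in[0,1)$ with $\alpha\notin D(T)$. Then for every integer $k\ge1$ and every $x\in X$, $$\lim_{N\to\infty}\sup_{P\in\mathbb{R}_{k-1}[t]}\left|\frac1N\sum_{n=0}^{N-1}e^{2\pi i(n^k\alpha+P(n))}f(T^nx)\right|=0.$$
   Context: $E_0(T)$: the set of $\lambda\in\mathbb{C}$ such that some nonzero $h\in L^2(\mu)$ satisfies $h\circ T=\lambda h$ $\mu$-a.e.; $G_0(T)$: the set of $\lambda$ such that some nonzero $h\in C(X)$ satisfies $h\circ T=\lambda h$. $D(T)=\{\alpha\in[0,1): \exists m\in\mathbb{Z}\setminus\{0\},\ e^{2\pi im\alpha}\in E_0(T)\}$. $\mathbb{R}_{j}[t]$ denotes real polynomials of degree at most $j$ ($\mathbb{R}_0[t]$ = real constants). *)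

theory Defs
  imports "HOL-Probability.Probability" "HOL-Computational_Algebra.Polynomial"
begin

definition tds :: "('a::metric_space \<Rightarrow> 'a) \<Rightarrow> bool" where
  "tds T \<longleftrightarrow> compact (UNIV :: 'a set) \<and> continuous_on UNIV T"

definition invariant_prob :: "('a::metric_space \<Rightarrow> 'a) \<Rightarrow> 'a measure \<Rightarrow> bool" where
  "invariant_prob T M \<longleftrightarrow> prob_space M \<and> sets M = sets borel \<and>
     T \<in> measurable M M \<and> distr M M T = M"

definition uniquely_ergodic :: "('a::metric_space \<Rightarrow> 'a) \<Rightarrow> 'a measure \<Rightarrow> bool" where
  "uniquely_ergodic T \<mu> \<longleftrightarrow> invariant_prob T \<mu> \<and> (\<forall>\<nu>. invariant_prob T \<nu> \<longrightarrow> \<nu> = \<mu>)"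

definition E0 :: "('a::metric_space \<Rightarrow> 'a) \<Rightarrow> 'a measure \<Rightarrow> complex set" where
  "E0 T \<mu> = {c. \<exists>h :: 'a \<Rightarrow> complex. h \<in> borel_measurable \<mu> \<and>
       integrable \<mu> (\<lambda>x. (cmod (h x))\<^sup>2) \<and> \<not> (AE x in \<mu>. h x = 0) \<and>
       (AE x in \<mu>. h (T x) = c * h x)}"

definition G0 :: "('a::metric_space \<Rightarrow> 'a) \<Rightarrow> complex set" where
  "G0 T = {c. \<exists>h :: 'a \<Rightarrow> complex. continuous_on UNIV h \<and> (\<exists>x. h x \<noteq> 0) \<and>
       (\<forall>x. h (T x) = c * h x)}"

definition D :: "('a::metric_space \<Rightarrow> 'a) \<Rightarrow> 'a measure \<Rightarrow> real set" where
  "D T \<mu> = {\<alpha>. 0 \<le> \<alpha> \<and> \<alpha> < 1 \<and>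
      (\<exists>m::int. m \<noteq> 0 \<and> exp (2 * pi * \<i> * of_int m * of_real \<alpha>) \<in> E0 T \<mu>)}"

end

theory Submission
  imports Defs
begin

text \<open>
  Van der Corput's inequality bounds an average with phase \<open>n\<^sup>k\<alpha> + P(n)\<close> by averages with phases
  \<open>k(h - l)\<alpha>n\<^sup>k\<^sup>-\<^sup>1 + R(n)\<close>, where \<open>deg R \<le> k - 2\<close>, and with the continuous functions
  \<open>f \<circ> T\<^sup>h \<sqdot> cnj (f \<circ> T\<^sup>l)\<close>. The bound is uniform in \<open>P\<close>, and nonzero integer multiples of \<open>\<alpha>\<close>
  inherit the hypothesis on \<open>\<alpha>\<close>, so induction on \<open>k\<close> leaves the linear case. There the constant term
  of the polynomial is irrelevant, and averaging over windows of length \<open>H\<close> together with unique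
  ergodicity bounds the upper limit of the averages by the \<open>L\<^sup>2(\<mu>)\<close>-norm of the
  \<open>H\<close>-th twisted ergodic average of \<open>f\<close>. By the mean ergodic theorem this norm tends to zero, as
  \<open>e\<^sup>-\<^sup>2\<^sup>\<pi>\<^sup>i\<^sup>\<alpha>\<close> is not an eigenvalue.
\<close>

section \<open>Averages over windows\<close>

lemma norm_average_le:
  fixes u :: "nat \<Rightarrow> complex"
  assumes "\<And>n. n < N \<Longrightarrow> norm (u n) \<le> B" and "0 \<le> B"
  shows "norm ((\<Sum>n<N. u n) / of_nat N) \<le> B"
proof (cases "N = 0")
  case False
  have "norm (\<Sum>n<N. u n) \<le> (\<Sum>n<N. B)"
    by (rule sum_norm_le) (use assms in simp)
  then show ?thesis using False by (simp add: norm_divide field_simps)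
qed (use assms in simp)

text \<open>A shift by one place exchanges only the boundary terms, \<open>u (N + h) - u h\<close>,
  so each unit of \<open>h\<close> costs at most \<open>2 * B\<close>.\<close>

lemma norm_sum_shift_diff_le:
  fixes u :: "nat \<Rightarrow> complex"
  assumes "\<And>n. norm (u n) \<le> B"
  shows "norm ((\<Sum>n<N. u (n + h)) - (\<Sum>n<N. u n)) \<le> 2 * B * real h"
proof (induction h)
  case 0
  then show ?case by simp
next
  case (Suc h)
  have "(\<Sum>n<N. u (Suc n + h)) - (\<Sum>n<N. u (n + h)) = u (N + h) - u h"
    using sum_lessThan_telescope[of "\<lambda>n. u (n + h)" N] by (simp add: sum_subtractf)
  moreover have "norm (u (N + h) - u h) \<le> B + B"
    by (intro order_trans[OF norm_triangle_ineq4] add_mono assms)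
  ultimately have "norm (((\<Sum>n<N. u (Suc n + h)) - (\<Sum>n<N. u (n + h)))
      + ((\<Sum>n<N. u (n + h)) - (\<Sum>n<N. u n))) \<le> (B + B) + 2 * B * real h"
    using Suc by (intro norm_triangle_le add_mono) auto
  then show ?case by (simp add: algebra_simps)
qed

text \<open>Exchanging the two sums turns the windowed average into the mean over
  \<open>h < H\<close> of shifted averages, and each shift is controlled by its boundary
  terms.\<close>

lemma norm_average_window_diff_le:
  fixes u :: "nat \<Rightarrow> complex"
  assumes u: "\<And>n. norm (u n) \<le> B" and N: "N > 0" and H: "H > 0"
  shows "norm ((\<Sum>n<N. u n) / of_nat N - (\<Sum>n<N. (\<Sum>h<H. u (n + h)) / of_nat H) / of_nat N)
           \<le> 2 * B * real H / real N"
proof -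
  have B: "0 \<le> B" using order_trans[OF norm_ge_zero u] .
  have "(\<Sum>n<N. (\<Sum>h<H. u (n + h)) / of_nat H) = (\<Sum>h<H. \<Sum>n<N. u (n + h)) / of_nat H"
    by (subst sum.swap) (simp add: sum_divide_distrib)
  moreover have "(\<Sum>n<N. u n) = (\<Sum>h<H. \<Sum>n<N. u n) / of_nat H"
    using H by simp
  ultimately have "(\<Sum>n<N. (\<Sum>h<H. u (n + h)) / of_nat H) - (\<Sum>n<N. u n)
      = (\<Sum>h<H. (\<Sum>n<N. u (n + h)) - (\<Sum>n<N. u n)) / of_nat H"
    by (simp only: sum_subtractf diff_divide_distrib)
  also have "norm \<dots> \<le> 2 * B * real H"
  proof (rule norm_average_le)
    fix h assume "h < H"
    then have "2 * B * real h \<le> 2 * B * real H"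
      using B by (intro mult_left_mono) auto
    then show "norm ((\<Sum>n<N. u (n + h)) - (\<Sum>n<N. u n)) \<le> 2 * B * real H"
      using norm_sum_shift_diff_le[of u B h N] u by fastforce
  qed (use B in simp)
  finally have "norm ((\<Sum>n<N. u n) - (\<Sum>n<N. (\<Sum>h<H. u (n + h)) / of_nat H)) \<le> 2 * B * real H"
    by (simp add: norm_minus_commute)
  then show ?thesis
    using N by (simp add: diff_divide_distrib[symmetric] norm_divide divide_right_mono)
qed

text \<open>This is the Cauchy-Schwarz inequality against the constant sequence one.\<close>

lemma norm_average_square_le:
  fixes v :: "nat \<Rightarrow> complex"
  shows "(norm ((\<Sum>n<N. v n) / of_nat N))\<^sup>2 \<le> (\<Sum>n<N. (norm (v n))\<^sup>2) / real N"
proof (cases "N = 0")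
  case False
  have "(norm (\<Sum>n<N. v n))\<^sup>2 \<le> (\<Sum>n<N. norm (v n))\<^sup>2"
    by (intro power_mono norm_sum) simp
  also have "\<dots> \<le> (\<Sum>n<N. (norm (v n))\<^sup>2) * real N"
    using sum_squared_le_sum_of_squares[of "\<lambda>n. norm (v n)" "{..<N}"] by simp
  finally show ?thesis
    using False by (simp add: norm_divide power_divide field_simps power2_eq_square)
qed simp

lemma norm_square_perturb:
  fixes a b :: complex
  assumes "norm a \<le> B" "norm b \<le> B" "norm (a - b) \<le> d"
  shows "(norm a)\<^sup>2 \<le> (norm b)\<^sup>2 + 2 * B * d"
proof -
  have "norm a - norm b \<le> d" using norm_triangle_ineq2[of a b] assms(3) by linarith
  have "(norm a)\<^sup>2 - (norm b)\<^sup>2 = (norm a - norm b) * (norm a + norm b)"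
    by (simp add: power2_eq_square algebra_simps)
  also have "\<dots> \<le> d * (norm a + norm b)"
    by (rule mult_right_mono) (use \<open>norm a - norm b \<le> d\<close> in auto)
  also have "\<dots> \<le> d * (2 * B)"
    by (rule mult_left_mono) (use assms order_trans[OF norm_ge_zero assms(3)] in auto)
  finally show ?thesis by (simp add: algebra_simps)
qed

text \<open>First half of van der Corput's inequality: window averages replace the terms, then
  Cauchy-Schwarz is applied to the outer average. A phase common to a whole window disappears on the
  right.\<close>

lemma norm_average_square_window_le:
  fixes u :: "nat \<Rightarrow> complex"
  assumes u: "\<And>n. norm (u n) \<le> B" and N: "N > 0" and H: "H > 0"
  shows "(norm ((\<Sum>n<N. u n) / of_nat N))\<^sup>2
           \<le> (\<Sum>n<N. (norm ((\<Sum>h<H. u (n + h)) / of_nat H))\<^sup>2) / real N + 4 * B\<^sup>2 * real H / real N"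
proof -
  let ?w = "\<lambda>n. (\<Sum>h<H. u (n + h)) / of_nat H"
  have B: "0 \<le> B" using order_trans[OF norm_ge_zero u] .
  have w: "norm (?w n) \<le> B" for n by (rule norm_average_le) (simp_all add: u B)
  have "(norm ((\<Sum>n<N. u n) / of_nat N))\<^sup>2
      \<le> (norm ((\<Sum>n<N. ?w n) / of_nat N))\<^sup>2 + 2 * B * (2 * B * real H / real N)"
    by (intro norm_square_perturb norm_average_le u w norm_average_window_diff_le N H B)
  also have "\<dots> \<le> (\<Sum>n<N. (norm (?w n))\<^sup>2) / real N + 2 * B * (2 * B * real H / real N)"
    using norm_average_square_le[of ?w N] by simp
  finally show ?thesis by (simp add: power2_eq_square)
qed

lemma norm_average_square_eq:
  fixes z :: "nat \<Rightarrow> complex"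
  shows "complex_of_real ((norm ((\<Sum>h<H. z h) / of_nat H))\<^sup>2)
     = (\<Sum>h<H. \<Sum>l<H. z h * cnj (z l)) / of_nat (H * H)"
  by (simp only: complex_norm_square)
     (simp add: sum_product sum_divide_distrib)

text \<open>Expanding the squared window averages gives correlations of pairs \<open>h\<close>,
  \<open>l\<close>. The \<open>H\<close> diagonal pairs contribute \<open>B\<^sup>2 / real H\<close>
  after division by \<open>H * H\<close>; the remaining pairs are bounded by
  \<open>\<delta>\<close>.\<close>

lemma van_der_Corput_bound:
  fixes u :: "nat \<Rightarrow> complex"
  assumes u: "\<And>n. norm (u n) \<le> B" and N: "N > 0" and H: "H > 0" and \<delta>: "\<delta> \<ge> 0"
    and corr: "\<And>h l. h < H \<Longrightarrow> l < H \<Longrightarrow> h \<noteq> l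
      \<Longrightarrow> norm ((\<Sum>n<N. u (n + h) * cnj (u (n + l))) / of_nat N) \<le> \<delta>"
  shows "(norm ((\<Sum>n<N. u n) / of_nat N))\<^sup>2 \<le> B\<^sup>2 / real H + \<delta> + 4 * B\<^sup>2 * real H / real N"
proof -
  let ?W = "\<lambda>n. (\<Sum>h<H. u (n + h)) / of_nat H"
  let ?c = "\<lambda>h l. (\<Sum>n<N. u (n + h) * cnj (u (n + l))) / of_nat N"
  have "complex_of_real ((\<Sum>n<N. (norm (?W n))\<^sup>2) / real N)
      = (\<Sum>n<N. (\<Sum>h<H. \<Sum>l<H. u (n + h) * cnj (u (n + l))) / of_nat (H * H)) / of_nat N"
    by (simp only: of_real_divide of_real_sum of_real_of_nat_eq norm_average_square_eq)
  \<comment> \<open>The average over \<open>n\<close> is moved innermost, where it becomes the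
    correlation \<open>?c h l\<close>.\<close>
  also have "\<dots> = (\<Sum>h<H. \<Sum>l<H. \<Sum>n<N. u (n + h) * cnj (u (n + l))) / of_nat (H * H) / of_nat N"
    by (simp only: sum_divide_distrib[symmetric] sum.swap[of _ "{..<H}" "{..<N}"])
  also have "\<dots> = (\<Sum>h<H. \<Sum>l<H. ?c h l) / of_nat (H * H)"
    by (simp add: sum_divide_distrib[symmetric])
  finally have "norm (complex_of_real ((\<Sum>n<N. (norm (?W n))\<^sup>2) / real N))
      = norm ((\<Sum>h<H. \<Sum>l<H. ?c h l) / of_nat (H * H))"
    by (rule arg_cong)
  \<comment> \<open>The identity was derived over the complex numbers; its left side is a
    nonnegative real and therefore equals its own norm.\<close>
  moreover have "0 \<le> (\<Sum>n<N. (norm (?W n))\<^sup>2) / real N"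
    by (intro divide_nonneg_nonneg sum_nonneg) simp_all
  ultimately have "(\<Sum>n<N. (norm (?W n))\<^sup>2) / real N = norm ((\<Sum>h<H. \<Sum>l<H. ?c h l) / of_nat (H * H))"
    by (simp only: norm_of_real abs_of_nonneg)
  also have "\<dots> = norm (\<Sum>h<H. \<Sum>l<H. ?c h l) / (real H * real H)"
    by (simp add: norm_divide norm_mult)
  also have "\<dots> \<le> (\<Sum>h<H. \<Sum>l<H. (if h = l then B\<^sup>2 else 0) + \<delta>) / (real H * real H)"
  proof (intro divide_right_mono sum_norm_le)
    fix h l assume "h \<in> {..<H}" "l \<in> {..<H}"
    show "norm (?c h l) \<le> (if h = l then B\<^sup>2 else 0) + \<delta>"
    proof (cases "h = l")
      case True
      have "norm (?c h l) \<le> B\<^sup>2"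
        by (rule norm_average_le)
           (auto simp: norm_mult power2_eq_square intro!: mult_mono u order_trans[OF norm_ge_zero u])
      then show ?thesis using True \<delta> by simp
    qed (use corr \<open>h \<in> {..<H}\<close> \<open>l \<in> {..<H}\<close> in simp)
  qed simp
  also have "\<dots> = B\<^sup>2 / real H + \<delta>"
    using H by (simp add: sum.distrib sum.delta' field_simps)
  finally show ?thesis
    using norm_average_square_window_le[of u B N H, OF u N H] by linarith
qed

section \<open>Orbit averages in uniquely ergodic systems\<close>

text \<open>The digits after place \<open>i\<close> sum to at most
  \<open>3 / 2 * (1 / 3 ^ Suc i)\<close>, half of the leading contribution. In base two the tail
  could cancel the leading digit completely.\<close>

lemma ternary_first_digit:
  fixes d :: "nat \<Rightarrow> real"
  assumes d: "\<And>j. \<bar>d j\<bar> \<le> 1" and zero: "\<And>j. j < i \<Longrightarrow> d j = 0" and i: "\<bar>d i\<bar> = 1"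
  shows "1 / (2 * 3 ^ i) \<le> \<bar>\<Sum>j. d j / 3 ^ j\<bar>"
proof -
  have geo: "(\<lambda>j. 1 / 3 ^ j * c) sums (3 / 2 * c)" for c :: real
    using geometric_sums[of "1 / 3 :: real"] by (intro sums_mult2) (simp add: power_divide)
  have bound: "norm (d (j + Suc i) / 3 ^ (j + Suc i)) \<le> 1 / 3 ^ j * (1 / 3 ^ Suc i)" for j
    using d[of "j + Suc i"] by (simp add: abs_divide power_add field_simps)
  have summ: "summable (\<lambda>j. d (j + Suc i) / 3 ^ (j + Suc i))"
    using summable_comparison_test'[OF sums_summable[OF geo] bound] .
  then have "summable (\<lambda>j. d j / 3 ^ j)"
    by (subst (asm) summable_iff_shift)
  then have "(\<Sum>j. d j / 3 ^ j)
      = (\<Sum>j. d (j + Suc i) / 3 ^ (j + Suc i)) + (\<Sum>j<Suc i. d j / 3 ^ j)"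
    by (rule suminf_split_initial_segment)
  moreover have "(\<Sum>j<Suc i. d j / 3 ^ j) = d i / 3 ^ i"
    using zero by simp
  moreover have "norm (\<Sum>j. d (j + Suc i) / 3 ^ (j + Suc i)) \<le> 3 / 2 * (1 / 3 ^ Suc i)"
    using norm_suminf_le[OF bound sums_summable[OF geo]] sums_unique[OF geo, of "1 / 3 ^ Suc i"]
    by simp
  moreover have "\<bar>d i / 3 ^ i\<bar> = 1 / 3 ^ i"
    using i by simp
  moreover have "1 / (2 * 3 ^ i) = 1 / 3 ^ i - 3 / 2 * (1 / 3 ^ Suc i :: real)"
    by (simp add: field_simps)
  ultimately show ?thesis
    unfolding real_norm_def by linarith
qed

text \<open>
  The code of a point is the ternary number whose digits record its membership in the balls of
  finite \<open>1/(m+1)\<close>-nets. It is not continuous, but its inverse is uniformly continuous.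
\<close>

lemma compact_metric_real_code:
  assumes "compact (UNIV :: 'a::metric_space set)"
  obtains \<kappa> :: "'a::metric_space \<Rightarrow> real" where "\<And>x. \<kappa> x \<in> {0..2}"
    and "\<And>e. e > 0 \<Longrightarrow> \<exists>d>0. \<forall>x y. \<bar>\<kappa> x - \<kappa> y\<bar> < d \<longrightarrow> dist x y < e"
proof -
  have "\<exists>k. finite k \<and> k \<subseteq> UNIV \<and> (UNIV :: 'a set) \<subseteq> (\<Union>x\<in>k. ball x (1 / real (Suc m)))" for m
    using seq_compact_imp_totally_bounded[OF assms[unfolded compact_eq_seq_compact_metric]] by simp
  then obtain F where F: "\<And>m. finite (F m) \<and> F m \<subseteq> UNIV
      \<and> (UNIV :: 'a set) \<subseteq> (\<Union>x\<in>F m. ball x (1 / real (Suc m)))"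
    using choice[of "\<lambda>m k. finite k \<and> k \<subseteq> UNIV
      \<and> (UNIV :: 'a set) \<subseteq> (\<Union>x\<in>k. ball x (1 / real (Suc m)))"] by blast
  then have fin: "finite (F m)"
    and cover: "(UNIV :: 'a set) \<subseteq> (\<Union>x\<in>F m. ball x (1 / real (Suc m)))" for m
    by simp_all
  \<comment> \<open>All pairs of a level and a centre are put into one enumeration, so that a single
    digit sequence tests balls of every radius.\<close>
  define S where "S = (SIGMA m:UNIV. F m)"
  have S: "countable S"
    unfolding S_def by (intro countable_SIGMA) (auto intro: countable_finite fin)
  define U where "U j = (case from_nat_into S j of (m, c) \<Rightarrow> ball c (1 / real (Suc m)))" for j
  define \<kappa> where "\<kappa> x = (\<Sum>j. of_bool (x \<in> U j) / 3 ^ j :: real)" for x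
  have geo: "(\<lambda>j. 1 / 3 ^ j :: real) sums (3 / 2)"
    using geometric_sums[of "1 / 3 :: real"] by (simp add: power_divide)
  have summ: "summable (\<lambda>j. of_bool (x \<in> U j) / 3 ^ j :: real)" for x
    by (rule summable_comparison_test'[OF sums_summable[OF geo]]) auto
  have \<kappa>: "\<kappa> x \<in> {0..2}" for x
  proof -
    have "\<kappa> x \<le> (\<Sum>j. 1 / 3 ^ j)"
      unfolding \<kappa>_def by (intro suminf_le summ sums_summable[OF geo]) auto
    moreover have "0 \<le> \<kappa> x"
      unfolding \<kappa>_def by (intro suminf_nonneg summ) auto
    ultimately show ?thesis
      using sums_unique[OF geo] by simp
  qed
  \<comment> \<open>A first disagreement at place \<open>i \<le> J\<close> would already separate
    the codes by \<open>1 / (2 * 3 ^ i)\<close>.\<close>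
  have digits: "x \<in> U j \<longleftrightarrow> y \<in> U j" if "\<bar>\<kappa> x - \<kappa> y\<bar> < 1 / (2 * 3 ^ J)" "j \<le> J" for x y j J
  proof (rule ccontr)
    assume ne: "(x \<in> U j) \<noteq> (y \<in> U j)"
    define i where "i = (LEAST i. (x \<in> U i) \<noteq> (y \<in> U i))"
    have i: "(x \<in> U i) \<noteq> (y \<in> U i)"
      unfolding i_def by (rule LeastI) (rule ne)
    have ij: "i \<le> j"
      unfolding i_def by (rule Least_le) (rule ne)
    have less: "(x \<in> U l) = (y \<in> U l)" if "l < i" for l
      using that not_less_Least unfolding i_def by blast
    have "1 / (2 * 3 ^ i) \<le> \<bar>\<Sum>l. (of_bool (x \<in> U l) - of_bool (y \<in> U l)) / 3 ^ l :: real\<bar>"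
      by (rule ternary_first_digit) (use i less in auto)
    also have "\<dots> = \<bar>\<kappa> x - \<kappa> y\<bar>"
      unfolding \<kappa>_def by (subst suminf_diff[OF summ summ]) (simp add: diff_divide_distrib)
    also have "\<dots> < 1 / (2 * 3 ^ J)" by fact
    also have "\<dots> \<le> 1 / (2 * 3 ^ i)"
      using ij that(2) by (intro divide_left_mono mult_left_mono power_increasing) auto
    finally show False by simp
  qed
  have "\<exists>d>0. \<forall>x y. \<bar>\<kappa> x - \<kappa> y\<bar> < d \<longrightarrow> dist x y < e" if e: "e > 0" for e
  proof -
    obtain m where m: "1 / real (Suc m) < e / 2"
      using nat_approx_posE[of "e / 2"] e by auto
    \<comment> \<open>\<open>J\<close> bounds the indices of all balls of level \<open>m\<close>, so
      points whose digits agree up to \<open>J\<close> share such a ball, of radius below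
      \<open>e / 2\<close>.\<close>
    define J where "J = Max (to_nat_on S ` (Pair m ` F m))"
    have "dist x y < e" if xy: "\<bar>\<kappa> x - \<kappa> y\<bar> < 1 / (2 * 3 ^ J)" for x y
    proof -
      obtain c where c: "c \<in> F m" "x \<in> ball c (1 / real (Suc m))"
        using subsetD[OF cover[of m] UNIV_I[of x]] by auto
      define j where "j = to_nat_on S (m, c)"
      have "j \<le> J"
        unfolding j_def J_def using c(1) fin by (intro Max_ge) auto
      moreover have "U j = ball c (1 / real (Suc m))"
        unfolding U_def j_def using S c(1) by (subst from_nat_into_to_nat_on) (auto simp: S_def)
      ultimately have "y \<in> ball c (1 / real (Suc m))"
        using digits[OF xy] c(2) by blast
      then show ?thesis
        using c(2) m dist_triangle2[of x y c] by (simp add: dist_commute)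
    qed
    then show ?thesis by (intro exI[of _ "1 / (2 * 3 ^ J)"]) auto
  qed
  then show ?thesis using that \<kappa> by blast
qed

text \<open>Although \<open>\<kappa>\<close> need not be continuous, its left inverse
  \<open>\<pi>\<close> is continuous on a compact set containing all codes. Measures on
  \<open>K\<close> can thus be carried to the phase space.\<close>

lemma compact_metric_real_parametrization:
  assumes comp: "compact (UNIV :: 'a::metric_space set)"
  obtains \<kappa> :: "'a::metric_space \<Rightarrow> real" and K \<pi> where "compact K" "K \<subseteq> {0..2}" "\<And>x. \<kappa> x \<in> K"
    "continuous_on K \<pi>" "\<And>x. \<pi> (\<kappa> x) = x"
proof -
  obtain \<kappa> :: "'a \<Rightarrow> real" where \<kappa>: "\<And>x. \<kappa> x \<in> {0..2}"
    and inv: "\<And>e. e > 0 \<Longrightarrow> \<exists>d>0. \<forall>x y. \<bar>\<kappa> x - \<kappa> y\<bar> < d \<longrightarrow> dist x y < e"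
    using compact_metric_real_code[OF comp] by blast
  \<comment> \<open>Uniform continuity of the inverse makes the compact closure of the transposed graph a graph.\<close>
  define G where "G = closure (range (\<lambda>x. (\<kappa> x, x)))"
  have sub: "G \<subseteq> {0..2} \<times> UNIV"
    unfolding G_def by (rule closure_minimal) (use \<kappa> in \<open>auto intro: closed_Times\<close>)
  have "compact ({0..2::real} \<times> (UNIV :: 'a set))"
    by (intro compact_Times comp) simp
  then have G: "compact G"
    using compact_Int_closed[of "{0..2} \<times> UNIV" G] sub
    by (simp add: inf.absorb2 G_def)
  have graph: "(\<kappa> x, x) \<in> G" for x
    unfolding G_def by (rule subsetD[OF closure_subset]) simp
  have inj: "inj_on fst G"
  proof (rule inj_onI)
    fix p q assume pq: "p \<in> G" "q \<in> G" "fst p = fst q"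
    \<comment> \<open>Graph points near \<open>p\<close> and \<open>q\<close> have codes within
      \<open>d\<close> of each other because the first coordinates agree. The three terms below
      \<open>e\<close> are the two approximation errors and the distance between the approximating
      points.\<close>
    have "dist (snd p) (snd q) < 3 * e" if e: "e > 0" for e
    proof -
      obtain d where d: "d > 0" "\<And>x y. \<bar>\<kappa> x - \<kappa> y\<bar> < d \<Longrightarrow> dist x y < e"
        using inv[OF e] by blast
      have near: "\<exists>x. dist (\<kappa> x, x) r < min e (d / 2)" if "r \<in> G" for r
      proof -
        have "\<forall>\<epsilon>>0. \<exists>s\<in>range (\<lambda>x. (\<kappa> x, x)). dist s r < \<epsilon>"
          using that unfolding G_def closure_approachable .
        moreover have "min e (d / 2) > 0" using e d(1) by simp
        ultimately have "\<exists>s\<in>range (\<lambda>x. (\<kappa> x, x)). dist s r < min e (d / 2)" by (elim allE impE)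
        then show ?thesis by simp
      qed
      obtain x where x: "dist (\<kappa> x, x) p < min e (d / 2)"
        using near[OF pq(1)] by blast
      obtain y where y: "dist (\<kappa> y, y) q < min e (d / 2)"
        using near[OF pq(2)] by blast
      have "dist (\<kappa> x) (fst p) < d / 2" "dist (\<kappa> y) (fst q) < d / 2"
        "dist x (snd p) < e" "dist y (snd q) < e"
        using x y dist_fst_le[of "(\<kappa> x, x)" p] dist_fst_le[of "(\<kappa> y, y)" q]
          dist_snd_le[of "(\<kappa> x, x)" p] dist_snd_le[of "(\<kappa> y, y)" q] by auto
      moreover from this have "dist x y < e"
        using pq(3) dist_triangle_half_l[of "\<kappa> x" "fst q" d "\<kappa> y"] by (intro d(2)) (simp add: dist_real_def)
      ultimately show ?thesis
        using dist_triangle[of "snd p" "snd q" x] dist_triangle[of x "snd q" y]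
        by (simp add: dist_commute)
    qed
    from this[of "dist (snd p) (snd q) / 3"] have "snd p = snd q"
      by (cases "snd p = snd q") simp_all
    then show "p = q" using pq(3) by (simp add: prod_eq_iff)
  qed
  \<comment> \<open>A continuous injection on a compact set has a continuous inverse, here that of
    the first projection on \<open>G\<close>.\<close>
  define \<pi> where "\<pi> = snd \<circ> the_inv_into G fst"
  show ?thesis
  proof (rule that[of "fst ` G" \<kappa> \<pi>])
    show "compact (fst ` G)"
      by (intro compact_continuous_image G continuous_intros)
    show "fst ` G \<subseteq> {0..2}" using sub by auto
    show "\<kappa> x \<in> fst ` G" for x using graph by force
    show "continuous_on (fst ` G) \<pi>"
      unfolding \<pi>_def by (intro continuous_on_compose continuous_on_inv_into G inj continuous_intros)
    show "\<pi> (\<kappa> x) = x" for x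
      unfolding \<pi>_def using the_inv_into_f_f[OF inj graph] by simp
  qed
qed

section \<open>Empirical measures and their weak limits\<close>

text \<open>Closed sets form an intersection-stable generator of the Borel sets, and the indicator
  of a nonempty closed set is a bounded pointwise limit of the continuous functions
  \<open>max 0 (1 - real n * infdist x C)\<close>.\<close>

lemma borel_measure_eqI_continuous:
  fixes M N :: "'a::metric_space measure"
  assumes M: "prob_space M" "sets M = sets borel" and N: "prob_space N" "sets N = sets borel"
    and eq: "\<And>\<phi> :: 'a \<Rightarrow> real. continuous_on UNIV \<phi> \<Longrightarrow> (\<And>x. \<bar>\<phi> x\<bar> \<le> 1)
               \<Longrightarrow> integral\<^sup>L M \<phi> = integral\<^sup>L N \<phi>"
  shows "M = N"
proof (rule measure_eqI_generator_eq[where E = "Collect closed" and \<Omega> = UNIV and A = "\<lambda>_. UNIV"])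
  show "Int_stable (Collect closed :: 'a set set)"
    by (auto simp: Int_stable_def)
  show "sets M = sigma_sets UNIV (Collect closed)" "sets N = sigma_sets UNIV (Collect closed)"
    using M N by (simp_all add: borel_eq_closed)
  interpret M: prob_space M by fact
  interpret N: prob_space N by fact
  show "emeasure M UNIV \<noteq> \<infinity>" by simp
  fix C :: "'a set" assume "C \<in> Collect closed"
  then have C: "closed C" by simp
  show "emeasure M C = emeasure N C"
  \<comment> \<open>The empty set is treated apart because \<open>infdist x {}\<close> is zero by
    convention.\<close>
  proof (cases "C = {}")
    case False
    define \<phi> where "\<phi> n x = max 0 (1 - real n * infdist x C)" for n x
    have cont: "continuous_on UNIV (\<phi> n)" for n
      unfolding \<phi>_def by (intro continuous_intros)
    have bound: "\<bar>\<phi> n x\<bar> \<le> 1" for n x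
      unfolding \<phi>_def by (auto simp: infdist_nonneg max_def)
    have lim: "(\<lambda>n. \<phi> n x) \<longlonglongrightarrow> indicator C x" for x
    proof (cases "x \<in> C")
      case True
      then show ?thesis by (simp add: \<phi>_def)
    next
      case False
      then have pos: "infdist x C > 0"
        using infdist_pos_not_in_closed[OF C \<open>C \<noteq> {}\<close>] by simp
      obtain n0 where n0: "1 / infdist x C < real n0"
        using reals_Archimedean2 by blast
      have "\<phi> n x = 0" if "n \<ge> n0" for n
      proof -
        have "1 < real n0 * infdist x C" using n0 pos by (simp add: field_simps)
        also have "\<dots> \<le> real n * infdist x C" using that pos by (intro mult_right_mono) auto
        finally show ?thesis by (simp add: \<phi>_def)
      qed
      then show ?thesis
        using False by (intro tendsto_eventually) (auto simp: eventually_sequentially)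
    qed
    have conv: "(\<lambda>n. integral\<^sup>L L (\<phi> n)) \<longlonglongrightarrow> measure L C"
      if L: "prob_space L" "sets L = sets borel" for L
    proof -
      interpret L: prob_space L by fact
      have meas: "\<phi> n \<in> borel_measurable L" for n
        using borel_measurable_continuous_onI[OF cont, of n] L(2)
        by (simp cong: measurable_cong_sets)
      have ind: "indicator C \<in> borel_measurable L" using C L(2) by (intro borel_measurable_indicator) auto
      have "(\<lambda>n. integral\<^sup>L L (\<phi> n)) \<longlonglongrightarrow> integral\<^sup>L L (indicator C)"
        by (rule integral_dominated_convergence[where w = "\<lambda>_. 1"])
           (use meas ind lim bound in auto)
      also have "integral\<^sup>L L (indicator C) = measure L C"
        using sets_eq_imp_space_eq[OF L(2)] by simp
      finally show ?thesis .
    qed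
    have "measure M C = measure N C"
      using conv[OF M] conv[OF N] eq[OF cont bound] LIMSEQ_unique by auto
    then show ?thesis by (simp add: M.emeasure_eq_measure N.emeasure_eq_measure)
  qed simp
qed auto

text \<open>The index set \<open>{..j}\<close> is never empty, so the uniform distribution exists
  for every \<open>j\<close>; the denominator is \<open>Suc j\<close> accordingly.\<close>

lemma integral_distr_uniform_orbit:
  fixes \<phi> :: "real \<Rightarrow> real"
  assumes "\<phi> \<in> borel_measurable borel"
  shows "integral\<^sup>L (distr (measure_pmf (pmf_of_set {..j::nat})) borel p) \<phi> = (\<Sum>n\<le>j. \<phi> (p n)) / real (Suc j)"
  by (subst integral_distr) (use assms in \<open>auto simp: integral_pmf_of_set\<close>)

text \<open>
  Coding transfers the empirical measures of an orbit to the real line, where Helly's selection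
  theorem replaces weak-* compactness; the weak limit is pushed back to the phase space.
\<close>

lemma uniquely_ergodic_average_tendsto_integral:
  fixes T :: "'a::metric_space \<Rightarrow> 'a" and g :: "'a \<Rightarrow> real"
  assumes tds: "tds T" and ue: "uniquely_ergodic T \<mu>" and g: "continuous_on UNIV g"
  shows "(\<lambda>N. (\<Sum>n<N. g ((T ^^ n) x)) / real N) \<longlonglongrightarrow> integral\<^sup>L \<mu> g"
proof -
  have comp: "compact (UNIV :: 'a set)" and T: "continuous_on UNIV T"
    using tds by (simp_all add: tds_def)
  obtain K and \<kappa> :: "'a \<Rightarrow> real" and \<pi> where K: "compact K" "K \<subseteq> {0..2}" "\<And>y. \<kappa> y \<in> K"
    and \<pi>: "continuous_on K \<pi>" "\<And>y. \<pi> (\<kappa> y) = y"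
    by (rule compact_metric_real_parametrization[OF comp]) (rule that)
  have Kcl: "closed K" by (rule compact_imp_closed) (rule K)
  have Kne: "K \<noteq> {}" using K(3) by auto
  define avg where "avg \<phi> j = (\<Sum>n\<le>j. \<phi> ((T ^^ n) x)) / real (Suc j)" for \<phi> :: "'a \<Rightarrow> real" and j
  define m where "m j = distr (measure_pmf (pmf_of_set {..j})) borel (\<lambda>n. \<kappa> ((T ^^ n) x))" for j
  have m_real: "real_distribution (m j)" for j
    unfolding m_def by (intro prob_space.real_distribution_distr measure_pmf.prob_space_axioms) simp
  have m_int: "integral\<^sup>L (m j) \<psi> = (\<Sum>n\<le>j. \<psi> (\<kappa> ((T ^^ n) x))) / real (Suc j)"
    if "\<psi> \<in> borel_measurable borel" for \<psi> :: "real \<Rightarrow> real" and j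
    unfolding m_def by (rule integral_distr_uniform_orbit) (rule that)
  \<comment> \<open>All codes lie in \<open>{0..2}\<close>, so every measure has full mass in the
    fixed half-open interval \<open>{-1<..3}\<close>.\<close>
  have tight: "tight m"
    unfolding tight_def
  proof (intro conjI allI impI m_real)
    fix \<epsilon> :: real assume "\<epsilon> > 0"
    have "measure (m j) {-1<..3} = 1" for j
    proof -
      have "\<kappa> y \<in> {-1<..3}" for y using K(2) K(3)[of y] by fastforce
      then have "(\<lambda>n. \<kappa> ((T ^^ n) x)) -` {-1<..3} = UNIV" by auto
      then show ?thesis
        unfolding m_def by (subst measure_distr) auto
    qed
    then show "\<exists>a b. a < b \<and> (\<forall>n. 1 - \<epsilon> < measure (m n) {a<..b})"
      using \<open>\<epsilon> > 0\<close> by (intro exI[of _ "-1"] exI[of _ 3]) auto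
  qed
  have "avg g \<longlonglongrightarrow> integral\<^sup>L \<mu> g"
  proof (rule ccontr)
    assume "\<not> avg g \<longlonglongrightarrow> integral\<^sup>L \<mu> g"
    then obtain e where "e > 0" and
      "\<not> (\<forall>\<^sub>F j in sequentially. dist (avg g j) (integral\<^sup>L \<mu> g) < e)"
      unfolding tendsto_iff by blast
    \<comment> \<open>The selection theorem is applied along indices where the averages stay away
      from the integral; unique ergodicity will contradict this.\<close>
    then obtain s :: "nat \<Rightarrow> nat" where s: "strict_mono s" "\<And>j. \<not> dist (avg g (s j)) (integral\<^sup>L \<mu> g) < e"
      by (auto dest!: not_eventually_sequentiallyD)
    obtain r M where r: "strict_mono r" and M: "real_distribution M"
      and weak: "weak_conv_m (m \<circ> s \<circ> r) M"
      using tight_imp_convergent_subsubsequence[OF tight s(1)] by auto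
    interpret M: real_distribution M by fact
    define t where "t = s \<circ> r"
    have t: "strict_mono t" unfolding t_def using s(1) r by (rule strict_mono_o)
    have lim: "(\<lambda>j. (\<Sum>n\<le>t j. \<psi> (\<kappa> ((T ^^ n) x))) / real (Suc (t j))) \<longlonglongrightarrow> integral\<^sup>L M \<psi>"
      if \<psi>: "continuous_on UNIV \<psi>" "\<And>y. norm (\<psi> y) \<le> B" for \<psi> :: "real \<Rightarrow> real" and B
    proof -
      have "(\<lambda>j. integral\<^sup>L ((m \<circ> s \<circ> r) j) \<psi>) \<longlonglongrightarrow> integral\<^sup>L M \<psi>"
        by (rule weak_conv_imp_integral_bdd_continuous_conv[OF _ M weak])
           (use \<psi> m_real in \<open>auto simp: continuous_on_eq_continuous_at\<close>)
      then show ?thesis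
        using borel_measurable_continuous_onI[OF \<psi>(1)] by (simp add: m_int t_def comp_assoc)
    qed
    \<comment> \<open>The truncated distance to \<open>K\<close> is a bounded continuous test
      function vanishing on all codes. Its integral against the weak limit is therefore zero, and
      \<open>K\<close> is closed.\<close>
    have AE_K: "AE u in M. u \<in> K"
    proof -
      define \<psi> where "\<psi> u = min 1 (infdist u K)" for u
      have cont: "continuous_on UNIV \<psi>" unfolding \<psi>_def by (intro continuous_intros)
      have bound: "norm (\<psi> u) \<le> 1" for u unfolding \<psi>_def by (simp add: infdist_nonneg)
      have "\<psi> (\<kappa> y) = 0" for y unfolding \<psi>_def using K(3) by simp
      then have "integral\<^sup>L M \<psi> = 0"
        using lim[OF cont bound] by (simp add: LIMSEQ_const_iff)
      moreover have "integrable M \<psi>"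
        using borel_measurable_continuous_onI[OF cont] bound
        by (intro M.integrable_const_bound[where B = 1]) auto
      ultimately have "AE u in M. \<psi> u = 0"
        by (subst (asm) integral_nonneg_eq_0_iff_AE) (auto simp: \<psi>_def infdist_nonneg)
      then show ?thesis
        by eventually_elim (use in_closed_iff_infdist_zero[OF Kcl Kne] in \<open>auto simp: \<psi>_def min_def split: if_splits\<close>)
    qed
    \<comment> \<open>The value \<open>x\<close> outside \<open>K\<close> is arbitrary, since the
      complement of \<open>K\<close> is a null set for \<open>M\<close>.\<close>
    define \<rho> where "\<rho> u = (if u \<in> K then \<pi> u else x)" for u
    have \<rho>: "\<rho> \<in> borel_measurable borel"
      unfolding \<rho>_def by (rule borel_measurable_continuous_on_if[OF borel_closed[OF Kcl] \<pi>(1)]) simp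
    define \<nu> where "\<nu> = distr M borel \<rho>"
    have \<nu>: "prob_space \<nu>" "sets \<nu> = sets borel"
      unfolding \<nu>_def using \<rho> by (auto intro: M.prob_space_distr)
    have lim\<nu>: "(\<lambda>j. avg \<phi> (t j)) \<longlonglongrightarrow> integral\<^sup>L \<nu> \<phi>" if \<phi>: "continuous_on UNIV \<phi>" for \<phi> :: "'a \<Rightarrow> real"
    proof -
      have "bounded (range \<phi>)"
        by (intro compact_imp_bounded compact_continuous_image \<phi> comp)
      then obtain B where B: "B > 0" "\<And>y. norm (\<phi> y) \<le> B"
        by (auto simp: bounded_pos)
      \<comment> \<open>Weak convergence tests functions on the whole line, whereas
        \<open>\<phi> \<circ> \<pi>\<close> is continuous only on \<open>K\<close>. Tietze's theorem
        extends it with the same bound, leaving its values at codes unchanged.\<close>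
      have "continuous_on K (\<lambda>u. \<phi> (\<pi> u))"
        by (rule continuous_on_compose2[OF \<phi> \<pi>(1)]) simp
      then obtain \<psi> where \<psi>: "continuous_on UNIV \<psi>" "\<And>u. u \<in> K \<Longrightarrow> \<psi> u = \<phi> (\<pi> u)"
        "\<And>u. u \<in> UNIV \<Longrightarrow> norm (\<psi> u) \<le> B"
        by (rule Tietze[of K "\<lambda>u. \<phi> (\<pi> u)" UNIV B]) (use Kcl B in \<open>auto intro: less_imp_le\<close>)
      have "integral\<^sup>L \<nu> \<phi> = integral\<^sup>L M (\<lambda>u. \<phi> (\<rho> u))"
        unfolding \<nu>_def using \<rho> borel_measurable_continuous_onI[OF \<phi>] by (subst integral_distr) auto
      also have "\<dots> = integral\<^sup>L M \<psi>"
      proof (rule integral_cong_AE)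
        show "AE u in M. \<phi> (\<rho> u) = \<psi> u"
          using AE_K by eventually_elim (simp add: \<rho>_def \<psi>(2))
      qed (use measurable_compose[OF \<rho> borel_measurable_continuous_onI[OF \<phi>]]
             borel_measurable_continuous_onI[OF \<psi>(1)] in auto)
      finally show ?thesis
        using lim[OF \<psi>(1) \<psi>(3)] \<psi>(2) K(3) \<pi>(2) by (simp add: avg_def)
    qed
    have invariant: "integral\<^sup>L \<nu> (\<lambda>y. \<phi> (T y)) = integral\<^sup>L \<nu> \<phi>"
      if \<phi>: "continuous_on UNIV \<phi>" "\<And>y. \<bar>\<phi> y\<bar> \<le> 1" for \<phi> :: "'a \<Rightarrow> real"
    proof -
      have cont: "continuous_on UNIV (\<lambda>y. \<phi> (T y))"
        by (rule continuous_on_compose2[OF \<phi>(1) T]) simp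
      \<comment> \<open>The two orbit sums telescope to a difference of end values, which is at most
        2.\<close>
      have "norm (avg (\<lambda>y. \<phi> (T y)) j - avg \<phi> j) \<le> 2 * inverse (real (Suc j))" for j
      proof -
        have "(\<Sum>n\<le>j. \<phi> (T ((T ^^ n) x))) - (\<Sum>n\<le>j. \<phi> ((T ^^ n) x)) = \<phi> ((T ^^ Suc j) x) - \<phi> x"
          using sum_lessThan_telescope[of "\<lambda>n. \<phi> ((T ^^ n) x)" "Suc j"]
          by (simp add: sum_subtractf lessThan_Suc_atMost)
        moreover have "\<bar>\<phi> ((T ^^ Suc j) x) - \<phi> x\<bar> \<le> 2"
          using \<phi>(2)[of "(T ^^ Suc j) x"] \<phi>(2)[of x] by linarith
        ultimately have "\<bar>(\<Sum>n\<le>j. \<phi> (T ((T ^^ n) x))) - (\<Sum>n\<le>j. \<phi> ((T ^^ n) x))\<bar> / real (Suc j) \<le> 2 / real (Suc j)"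
          by (intro divide_right_mono) (simp_all only: of_nat_0_le_iff)
        then show ?thesis
          unfolding avg_def diff_divide_distrib[symmetric] real_norm_def abs_divide abs_of_nat
          by (simp only: divide_inverse)
      qed
      then have "\<forall>\<^sub>F j in sequentially. norm (avg (\<lambda>y. \<phi> (T y)) j - avg \<phi> j) \<le> 2 * inverse (real (Suc j))"
        by (intro always_eventually allI)
      moreover have "(\<lambda>j. 2 * inverse (real (Suc j))) \<longlonglongrightarrow> 0"
        by (rule tendsto_mult_right_zero) (rule LIMSEQ_inverse_real_of_nat)
      ultimately have "(\<lambda>j. avg (\<lambda>y. \<phi> (T y)) j - avg \<phi> j) \<longlonglongrightarrow> 0"
        by (rule Lim_null_comparison)
      from LIMSEQ_subseq_LIMSEQ[OF this t]
      have "(\<lambda>j. avg (\<lambda>y. \<phi> (T y)) (t j) - avg \<phi> (t j)) \<longlonglongrightarrow> 0"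
        by (simp add: o_def)
      moreover have "(\<lambda>j. avg (\<lambda>y. \<phi> (T y)) (t j) - avg \<phi> (t j))
          \<longlonglongrightarrow> integral\<^sup>L \<nu> (\<lambda>y. \<phi> (T y)) - integral\<^sup>L \<nu> \<phi>"
        by (intro tendsto_diff lim\<nu> cont \<phi>)
      ultimately show ?thesis using LIMSEQ_unique by fastforce
    qed
    have Tb: "T \<in> measurable borel borel" using borel_measurable_continuous_onI[OF T] .
    have T\<nu>: "T \<in> measurable \<nu> \<nu>" using Tb \<nu>(2) by (simp cong: measurable_cong_sets)
    have "distr \<nu> \<nu> T = \<nu>"
    proof (rule borel_measure_eqI_continuous)
      show "prob_space (distr \<nu> \<nu> T)" by (rule prob_space.prob_space_distr[OF \<nu>(1) T\<nu>])
      show "prob_space \<nu>" "sets \<nu> = sets borel" "sets (distr \<nu> \<nu> T) = sets borel"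
        using \<nu> by simp_all
      fix \<phi> :: "'a \<Rightarrow> real" assume \<phi>: "continuous_on UNIV \<phi>" "\<And>x. \<bar>\<phi> x\<bar> \<le> 1"
      have "\<phi> \<in> borel_measurable \<nu>"
        using borel_measurable_continuous_onI[OF \<phi>(1)] \<nu>(2) by (simp cong: measurable_cong_sets)
      then show "integral\<^sup>L (distr \<nu> \<nu> T) \<phi> = integral\<^sup>L \<nu> \<phi>"
        using invariant[OF \<phi>] by (subst integral_distr[OF T\<nu>]) auto
    qed
    then have "invariant_prob T \<nu>" unfolding invariant_prob_def using \<nu> T\<nu> by simp
    then have "\<nu> = \<mu>" using ue by (simp add: uniquely_ergodic_def)
    then have "\<forall>\<^sub>F j in sequentially. dist (avg g (t j)) (integral\<^sup>L \<mu> g) < e"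
      using lim\<nu>[OF g] \<open>e > 0\<close> by (auto simp: tendsto_iff)
    then show False
      using s(2) by (auto simp: t_def eventually_sequentially)
  qed
  \<comment> \<open>\<open>avg g j\<close> has \<open>Suc j\<close> terms, so an index shift returns
    to sums over \<open>n < N\<close>.\<close>
  then have "(\<lambda>j. (\<Sum>n<Suc j. g ((T ^^ n) x)) / real (Suc j)) \<longlonglongrightarrow> integral\<^sup>L \<mu> g"
    by (simp only: avg_def[abs_def] lessThan_Suc_atMost)
  then show ?thesis by (subst (asm) filterlim_sequentially_Suc)
qed

section \<open>Twisted mean ergodic theorem\<close>

text \<open>This is the ordinary ergodic average of \<open>f\<close> under the operator sending
  \<open>g\<close> to \<open>cis (2 * pi * \<beta>) * g \<circ> T\<close>.\<close>

definition twisted_average :: "('a \<Rightarrow> 'a) \<Rightarrow> ('a \<Rightarrow> complex) \<Rightarrow> real \<Rightarrow> nat \<Rightarrow> 'a \<Rightarrow> complex" where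
  "twisted_average T f \<beta> H y = (\<Sum>h<H. cis (2 * pi * real h * \<beta>) * f ((T ^^ h) y)) / of_nat H"

lemma norm_twisted_average_le:
  assumes "\<And>y. norm (f y) \<le> B"
  shows "norm (twisted_average T f \<beta> H y) \<le> B"
  unfolding twisted_average_def
  by (rule norm_average_le) (use assms order_trans[OF norm_ge_zero assms] in \<open>simp_all add: norm_mult\<close>)

text \<open>The phase of a window starting at \<open>n\<close> factors out, so the modulus of a
  window average is that of one fixed function along the orbit.\<close>

lemma twisted_average_shift:
  "(\<Sum>h<H. cis (2 * pi * real (n + h) * \<beta>) * f ((T ^^ (n + h)) y)) / of_nat H
     = cis (2 * pi * real n * \<beta>) * twisted_average T f \<beta> H ((T ^^ n) y)"
proof -
  have "cis (2 * pi * real (n + h) * \<beta>) * f ((T ^^ (n + h)) y)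
      = cis (2 * pi * real n * \<beta>) * (cis (2 * pi * real h * \<beta>) * f ((T ^^ h) ((T ^^ n) y)))" for h
    by (subst add.commute[of n h]) (simp add: funpow_add cis_mult algebra_simps)
  then show ?thesis
    by (simp add: twisted_average_def sum_distrib_left)
qed

lemma continuous_on_funpow:
  fixes T :: "'a::topological_space \<Rightarrow> 'a"
  assumes "continuous_on UNIV T"
  shows "continuous_on UNIV (T ^^ n)"
proof (induction n)
  case (Suc n)
  then show ?case
    using continuous_on_compose2[OF assms Suc] by (simp add: o_def)
qed (simp add: id_def)

lemma continuous_on_twisted_average:
  fixes T :: "'a::topological_space \<Rightarrow> 'a"
  assumes "continuous_on UNIV T" "continuous_on UNIV f"
  shows "continuous_on UNIV (twisted_average T f \<beta> H)"
  unfolding twisted_average_def[abs_def] divide_inverse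
  by (intro continuous_intros continuous_on_compose2[OF assms(2)] continuous_on_funpow assms(1)) auto

lemma invariant_prob_integral_funpow:
  fixes g :: "'a::metric_space \<Rightarrow> real"
  assumes inv: "invariant_prob T \<mu>" and g: "g \<in> borel_measurable \<mu>"
  shows "integral\<^sup>L \<mu> (\<lambda>y. g ((T ^^ n) y)) = integral\<^sup>L \<mu> g"
proof -
  have T: "T \<in> measurable \<mu> \<mu>" and eq: "distr \<mu> \<mu> T = \<mu>"
    using inv by (simp_all add: invariant_prob_def)
  have meas: "T ^^ n \<in> measurable \<mu> \<mu>" for n
  proof (induction n)
    case (Suc n)
    then show ?case using measurable_comp[OF Suc T] by (simp add: comp_def)
  qed (simp add: id_def)
  show ?thesis
  proof (induction n)
    case (Suc n)
    have "integral\<^sup>L \<mu> (\<lambda>y. g ((T ^^ n) y)) = integral\<^sup>L (distr \<mu> \<mu> T) (\<lambda>y. g ((T ^^ n) y))"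
      by (simp only: eq)
    also have "\<dots> = integral\<^sup>L \<mu> (\<lambda>y. g ((T ^^ n) (T y)))"
      by (rule integral_distr[OF T]) (rule measurable_compose[OF meas g])
    finally show ?case using Suc by (simp add: funpow_swap1)
  qed simp
qed

section \<open>Mean-square convergence of twisted averages\<close>

text \<open>A long average is nearly an orbit average of windows of length \<open>H\<close>, and of
  length \<open>K\<close>, hence of their midpoint; Cauchy-Schwarz and invariance give the bound.
  With \<open>H = K\<close> it shows that long averages cannot be much larger than a short
  one.\<close>

lemma twisted_average_L2_le_midpoint:
  fixes T :: "'a::metric_space \<Rightarrow> 'a" and f :: "'a \<Rightarrow> complex"
  assumes inv: "invariant_prob T \<mu>" and T: "continuous_on UNIV T"
    and f: "continuous_on UNIV f" "\<And>y. norm (f y) \<le> B"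
    and pos: "H > 0" "K > 0" "L > 0"
  shows "(\<integral>y. (norm (twisted_average T f \<beta> L y))\<^sup>2 \<partial>\<mu>)
    \<le> (\<integral>y. (norm ((twisted_average T f \<beta> H y + twisted_average T f \<beta> K y) / 2))\<^sup>2 \<partial>\<mu>)
       + 4 * B\<^sup>2 * real (H + K) / real L"
proof -
  let ?A = "twisted_average T f \<beta>"
  let ?U = "\<lambda>y n. cis (2 * pi * real n * \<beta>) * f ((T ^^ n) y)"
  let ?M = "\<lambda>y. (?A H y + ?A K y) / 2"
  have B: "0 \<le> B" using order_trans[OF norm_ge_zero f(2)] .
  have U: "norm (?U y n) \<le> B" for y n using f(2) by (simp add: norm_mult)
  interpret prob_space \<mu> using inv by (simp add: invariant_prob_def)
  have sets: "sets \<mu> = sets borel" using inv by (simp add: invariant_prob_def)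
  have A: "norm (?A N y) \<le> B" for N y by (rule norm_twisted_average_le) (rule f)
  have M: "norm (?M y) \<le> B" for y
    using norm_triangle_ineq[of "?A H y" "?A K y"] A[of H y] A[of K y] by (simp add: norm_divide)
  have cont: "continuous_on UNIV (\<lambda>y. (norm (?A N y))\<^sup>2)" "continuous_on UNIV (\<lambda>y. (norm (?M y))\<^sup>2)" for N
    by (intro continuous_intros continuous_on_twisted_average T f(1); simp)+
  have integrable: "integrable \<mu> \<phi>" if "continuous_on UNIV \<phi>" "\<And>y. norm (\<phi> y) \<le> B\<^sup>2" for \<phi> :: "'a \<Rightarrow> real"
    using borel_measurable_continuous_onI[OF that(1)] that(2) sets
    by (intro integrable_const_bound[where B = "B\<^sup>2"]) (auto cong: measurable_cong_sets)
  have iA: "integrable \<mu> (\<lambda>y. (norm (?A N y))\<^sup>2)" for N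
    by (rule integrable[OF cont(1)]) (use A in \<open>auto intro: power_mono\<close>)
  have "continuous_on UNIV (\<lambda>y. (norm (?M ((T ^^ n) y)))\<^sup>2)" for n
    using continuous_on_compose2[OF cont(2) continuous_on_funpow[OF T]] by simp
  then have iM: "integrable \<mu> (\<lambda>y. (norm (?M ((T ^^ n) y)))\<^sup>2)" for n
    by (rule integrable) (use M in \<open>auto intro!: power_mono\<close>)
  have pointwise: "(norm (?A L y))\<^sup>2 \<le> (\<Sum>n<L. (norm (?M ((T ^^ n) y)))\<^sup>2) / real L + 4 * B\<^sup>2 * real (H + K) / real L" for y
  proof -
    define v where "v n = cis (2 * pi * real n * \<beta>) * ?M ((T ^^ n) y)" for n
    have v: "norm (v n) \<le> B" for n unfolding v_def using M by (simp add: norm_mult)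
    have win: "norm (?A L y - (\<Sum>n<L. cis (2 * pi * real n * \<beta>) * ?A N ((T ^^ n) y)) / of_nat L)
        \<le> 2 * B * real N / real L" if "N > 0" for N
      using norm_average_window_diff_le[of "?U y", OF U pos(3) that]
      by (simp only: twisted_average_shift) (simp only: twisted_average_def)
    have "?A L y - (\<Sum>n<L. v n) / of_nat L
       = ((?A L y - (\<Sum>n<L. cis (2 * pi * real n * \<beta>) * ?A H ((T ^^ n) y)) / of_nat L)
         + (?A L y - (\<Sum>n<L. cis (2 * pi * real n * \<beta>) * ?A K ((T ^^ n) y)) / of_nat L)) / 2"
      by (simp add: v_def ring_distribs add_divide_distrib sum.distrib sum_divide_distrib[symmetric])
    also have "norm \<dots> \<le> (2 * B * real H / real L + 2 * B * real K / real L) / 2"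
      by (simp only: norm_divide norm_numeral) (intro divide_right_mono norm_triangle_le add_mono win pos, simp)
    also have "\<dots> = B * real (H + K) / real L"
      by (simp add: add_divide_distrib ring_distribs)
    \<comment> \<open>The factor 2 is given away to reach the constant \<open>4 * B\<^sup>2\<close>
      of the statement.\<close>
    also have "\<dots> \<le> 2 * B * real (H + K) / real L"
      using B by (intro divide_right_mono mult_right_mono) auto
    finally have "(norm (?A L y))\<^sup>2 \<le> (norm ((\<Sum>n<L. v n) / of_nat L))\<^sup>2 + 2 * B * (2 * B * real (H + K) / real L)"
      by (intro norm_square_perturb A norm_average_le v B)
    also have "\<dots> \<le> (\<Sum>n<L. (norm (v n))\<^sup>2) / real L + 2 * B * (2 * B * real (H + K) / real L)"
      using norm_average_square_le[of v L] by simp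
    finally show ?thesis
      by (simp add: v_def norm_mult power2_eq_square)
  qed
  have shift: "(\<integral>y. (norm (?M ((T ^^ n) y)))\<^sup>2 \<partial>\<mu>) = (\<integral>y. (norm (?M y))\<^sup>2 \<partial>\<mu>)" for n
    using borel_measurable_continuous_onI[OF cont(2)] sets
    by (intro invariant_prob_integral_funpow[OF inv]) (simp cong: measurable_cong_sets)
  have "(\<integral>y. (norm (?A L y))\<^sup>2 \<partial>\<mu>)
      \<le> (\<integral>y. (\<Sum>n<L. (norm (?M ((T ^^ n) y)))\<^sup>2) / real L + 4 * B\<^sup>2 * real (H + K) / real L \<partial>\<mu>)"
    by (intro integral_mono iA iM pointwise Bochner_Integration.integrable_add integrable_divide_zero Bochner_Integration.integrable_sum integrable_const)
  also have "\<dots> = (\<Sum>n<L. \<integral>y. (norm (?M ((T ^^ n) y)))\<^sup>2 \<partial>\<mu>) / real L + 4 * B\<^sup>2 * real (H + K) / real L"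
    using iM by (simp add: prob_space)
  also have "\<dots> = (\<Sum>n<L. \<integral>y. (norm (?M y))\<^sup>2 \<partial>\<mu>) / real L + 4 * B\<^sup>2 * real (H + K) / real L"
    by (simp only: shift)
  finally show ?thesis using pos(3) by simp
qed

text \<open>The increments have summable mean absolute values, so almost everywhere they are
  absolutely summable and the sequence telescopes to a limit.\<close>

lemma AE_convergent_if_L2_fast_Cauchy:
  fixes F :: "nat \<Rightarrow> 'a \<Rightarrow> complex"
  assumes "prob_space M" and F: "\<And>j. F j \<in> borel_measurable M"
    and int: "\<And>j. integrable M (\<lambda>y. (norm (F (Suc j) y - F j y))\<^sup>2)"
    and fast: "\<And>j. (\<integral>y. (norm (F (Suc j) y - F j y))\<^sup>2 \<partial>M) \<le> (1 / 4) ^ j"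
  shows "AE y in M. convergent (\<lambda>j. F j y)"
proof -
  interpret prob_space M by fact
  let ?d = "\<lambda>j y. norm (F (Suc j) y - F j y)"
  have meas: "?d j \<in> borel_measurable M" for j using F by measurable
  \<comment> \<open>The weight \<open>2 ^ j\<close> balances the two terms: a mean square of at most
    \<open>(1 / 4) ^ j\<close> makes both at most \<open>(1 / 2) ^ j\<close>.\<close>
  have amgm: "t \<le> (2 ^ j * t\<^sup>2 + (1 / 2) ^ j) / 2" for t :: real and j
  proof -
    have "0 \<le> (2 ^ j * t - 1)\<^sup>2 / 2 ^ j" by simp
    also have "\<dots> = 2 ^ j * t\<^sup>2 + (1 / 2) ^ j - 2 * t"
      by (simp add: power2_eq_square field_simps)
    finally show ?thesis by simp
  qed
  have bound: "(\<integral>\<^sup>+y. ennreal (?d j y) \<partial>M) \<le> ennreal ((1 / 2) ^ j)" for j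
  proof -
    have "integrable M (\<lambda>y. 2 ^ j * (?d j y)\<^sup>2 + (1 / 2) ^ j)"
      by (intro Bochner_Integration.integrable_add integrable_mult_right int integrable_const)
    then have int': "integrable M (\<lambda>y. (2 ^ j * (?d j y)\<^sup>2 + (1 / 2) ^ j) / 2)"
      by (rule integrable_divide_zero)
    have "(\<integral>\<^sup>+y. ennreal (?d j y) \<partial>M) \<le> (\<integral>\<^sup>+y. ennreal ((2 ^ j * (?d j y)\<^sup>2 + (1 / 2) ^ j) / 2) \<partial>M)"
      by (intro nn_integral_mono ennreal_leI amgm)
    also have "\<dots> = ennreal (\<integral>y. (2 ^ j * (?d j y)\<^sup>2 + (1 / 2) ^ j) / 2 \<partial>M)"
      by (rule nn_integral_eq_integral[OF int']) simp
    also have "(\<integral>y. (2 ^ j * (?d j y)\<^sup>2 + (1 / 2) ^ j) / 2 \<partial>M)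
        = (2 ^ j * (\<integral>y. (?d j y)\<^sup>2 \<partial>M) + (1 / 2) ^ j) / 2"
      using int[of j] by (simp add: prob_space)
    also have "\<dots> \<le> (2 ^ j * (1 / 4) ^ j + (1 / 2) ^ j) / 2"
      by (intro divide_right_mono add_right_mono mult_left_mono fast) auto
    also have "\<dots> = (1 / 2) ^ j"
      by (simp add: power_mult_distrib[symmetric])
    finally show ?thesis by (simp add: ennreal_leI)
  qed
  have "(\<integral>\<^sup>+y. (\<Sum>j. ennreal (?d j y)) \<partial>M) = (\<Sum>j. \<integral>\<^sup>+y. ennreal (?d j y) \<partial>M)"
    by (intro nn_integral_suminf measurable_compose[OF meas measurable_ennreal])
  also have "\<dots> \<le> (\<Sum>j. ennreal ((1 / 2) ^ j))"
    by (intro suminf_le bound summableI)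
  also have "\<dots> = ennreal (\<Sum>j. (1 / 2) ^ j)"
    by (intro suminf_ennreal2 summable_geometric) auto
  also have "\<dots> < \<infinity>" by simp
  finally have "AE y in M. (\<Sum>j. ennreal (?d j y)) \<noteq> \<infinity>"
    using meas by (intro nn_integral_PInf_AE) auto
  then show ?thesis
  proof eventually_elim
    case (elim y)
    then have "summable (\<lambda>j. ?d j y)"
      by (intro summable_suminf_not_top) auto
    then have "summable (\<lambda>j. F (Suc j) y - F j y)"
      by (rule summable_norm_cancel)
    then have "convergent (\<lambda>n. \<Sum>j<n. F (Suc j) y - F j y)"
      by (simp add: summable_iff_convergent)
    then have "convergent (\<lambda>n. F n y - F 0 y)"
      by (simp only: sum_lessThan_telescope[of "\<lambda>j. F j y"])
    then show ?case
      using convergent_add[OF _ convergent_const, of "\<lambda>n. F n y - F 0 y" "F 0 y"] by simp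
  qed
qed

text \<open>Composition with \<open>T\<close> and multiplication by the phase move the window by one
  place. Limits of the averages are thus eigenfunctions for
  \<open>cis (- (2 * pi * \<beta>))\<close>, up to being zero.\<close>

lemma twisted_average_equivariant:
  assumes "\<And>y. norm (f y) \<le> B" and H: "H > 0"
  shows "norm (cis (2 * pi * \<beta>) * twisted_average T f \<beta> H (T y) - twisted_average T f \<beta> H y) \<le> 2 * B / real H"
proof -
  let ?U = "\<lambda>n. cis (2 * pi * real n * \<beta>) * f ((T ^^ n) y)"
  have "cis (2 * pi * \<beta>) * twisted_average T f \<beta> H (T y) - twisted_average T f \<beta> H y
      = ((\<Sum>h<H. ?U (h + 1)) - (\<Sum>h<H. ?U h)) / of_nat H"
    using twisted_average_shift[of 1 \<beta> f T y H]
    by (auto simp: twisted_average_def diff_divide_distrib add.commute)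
  also have "norm \<dots> \<le> 2 * B / real H"
    using norm_sum_shift_diff_le[of ?U B 1 H] assms
    by (simp add: norm_divide norm_mult divide_right_mono)
  finally show ?thesis .
qed

text \<open>
  By the parallelogram law, the twisted averages form a Cauchy sequence in the mean square once
  their norms, and those of their midpoints, are bounded below by the infimum of the norms. A
  nonzero limit would be an eigenfunction.
\<close>

lemma twisted_mean_ergodic:
  fixes T :: "'a::metric_space \<Rightarrow> 'a" and f :: "'a \<Rightarrow> complex"
  assumes inv: "invariant_prob T \<mu>" and T: "continuous_on UNIV T"
    and f: "continuous_on UNIV f" "\<And>y. norm (f y) \<le> B"
    and noeig: "cis (- (2 * pi * \<beta>)) \<notin> E0 T \<mu>" and e: "e > 0"
  shows "\<exists>H>0. (\<integral>y. (norm (twisted_average T f \<beta> H y))\<^sup>2 \<partial>\<mu>) < e"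
proof (rule ccontr)
  assume contra: "\<not> ?thesis"
  let ?A = "twisted_average T f \<beta>"
  define q where "q H = (\<integral>y. (norm (?A H y))\<^sup>2 \<partial>\<mu>)" for H
  define mid where "mid H K = (\<integral>y. (norm ((?A H y + ?A K y) / 2))\<^sup>2 \<partial>\<mu>)" for H K
  define c where "c = Inf (q ` {0<..})"
  have qe: "e \<le> q H" if "H > 0" for H
    using contra that unfolding q_def by (meson not_less)
  have bdd: "bdd_below (q ` {0<..})" using qe by (intro bdd_belowI2[of _ e]) auto
  have c_le: "c \<le> q H" if "H > 0" for H
    unfolding c_def using bdd that by (intro cInf_lower) auto
  have B: "0 \<le> B" using order_trans[OF norm_ge_zero f(2)] .
  interpret prob_space \<mu> using inv by (simp add: invariant_prob_def)
  have sets: "sets \<mu> = sets borel" using inv by (simp add: invariant_prob_def)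
  have A: "norm (?A N y) \<le> B" for N y by (rule norm_twisted_average_le) (rule f)
  have meas: "?A N \<in> borel_measurable \<mu>" for N
    using borel_measurable_continuous_onI[OF continuous_on_twisted_average[OF T f(1)]] sets
    by (simp cong: measurable_cong_sets)
  have aux: "q L \<le> mid H K + 4 * B\<^sup>2 * real (H + K) / real L" if "H > 0" "K > 0" "L > 0" for H K L
    unfolding q_def mid_def by (rule twisted_average_L2_le_midpoint[OF inv T f that])
  have small: "(\<lambda>L. b / real L) \<longlonglongrightarrow> 0" for b
    by (rule lim_const_over_n)
  \<comment> \<open>With \<open>H\<close> and \<open>K\<close> fixed, \<open>L\<close> tends to
    infinity in \<open>aux\<close>.\<close>
  have mid_ge: "c \<le> mid H K" if HK: "H > 0" "K > 0" for H K
  proof (rule LIMSEQ_le_const)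
    show "(\<lambda>L. mid H K + 4 * B\<^sup>2 * real (H + K) / real L) \<longlonglongrightarrow> mid H K"
      using tendsto_add[OF tendsto_const small] by simp
    show "\<exists>N. \<forall>L\<ge>N. c \<le> mid H K + 4 * B\<^sup>2 * real (H + K) / real L"
      using aux[OF HK] c_le by (intro exI[of _ 1] allI impI) (metis order_trans less_eq_Suc_le One_nat_def)
  qed
  \<comment> \<open>For \<open>H = K\<close> the midpoint is the average itself, so one nearly
    minimal \<open>H\<close> forces all long averages to be nearly minimal.\<close>
  have q_lim: "\<exists>L0. \<forall>L\<ge>L0. q L \<le> c + d" if d: "d > 0" for d
  proof -
    obtain H where H: "H > 0" "q H < c + d / 2"
      using cInf_lessD[of "q ` {0<..}" "c + d / 2"] d unfolding c_def by auto
    have "\<forall>\<^sub>F L in sequentially. 4 * B\<^sup>2 * real (H + H) / real L < d / 2"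
      using order_tendstoD(2)[OF small] d by simp
    then obtain L0 where L0: "\<And>L. L \<ge> L0 \<Longrightarrow> 4 * B\<^sup>2 * real (H + H) / real L < d / 2"
      by (auto simp: eventually_sequentially)
    have "q L \<le> c + d" if "L \<ge> max 1 L0" for L
    proof -
      have "mid H H = q H" by (simp add: mid_def q_def)
      then show ?thesis using aux[OF H(1) H(1), of L] L0[of L] H(2) that by simp
    qed
    then show ?thesis by blast
  qed
  have int: "integrable \<mu> (\<lambda>y. (norm (g y))\<^sup>2)"
    if "g \<in> borel_measurable \<mu>" "AE y in \<mu>. norm (g y) \<le> C" for g :: "'a \<Rightarrow> complex" and C
  proof (rule integrable_const_bound[where B = "C\<^sup>2"])
    show "AE y in \<mu>. norm ((norm (g y))\<^sup>2) \<le> C\<^sup>2"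
      using that(2) by eventually_elim (simp add: power_mono)
    show "(\<lambda>y. (norm (g y))\<^sup>2) \<in> borel_measurable \<mu>" using that(1) by measurable
  qed
  have int_A: "integrable \<mu> (\<lambda>y. (norm (?A H y))\<^sup>2)" for H
    using A by (intro int[OF meas]) auto
  have int_diff: "integrable \<mu> (\<lambda>y. (norm (?A H y - ?A K y))\<^sup>2)" for H K
  proof (rule int[of _ "2 * B"])
    show "(\<lambda>y. ?A H y - ?A K y) \<in> borel_measurable \<mu>"
      by (intro borel_measurable_diff meas)
    have "norm (?A H y - ?A K y) \<le> 2 * B" for y
      using norm_triangle_ineq4[of "?A H y" "?A K y"] A[of H y] A[of K y] by linarith
    then show "AE y in \<mu>. norm (?A H y - ?A K y) \<le> 2 * B" by simp
  qed
  have int_mid: "integrable \<mu> (\<lambda>y. (norm ((?A H y + ?A K y) / 2))\<^sup>2)" for H K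
  proof (rule int[of _ B])
    show "(\<lambda>y. (?A H y + ?A K y) / 2) \<in> borel_measurable \<mu>"
      by (intro borel_measurable_divide borel_measurable_add borel_measurable_const meas)
    have "norm ((?A H y + ?A K y) / 2) \<le> B" for y
      using norm_triangle_ineq[of "?A H y" "?A K y"] A[of H y] A[of K y] by (simp add: norm_divide)
    then show "AE y in \<mu>. norm ((?A H y + ?A K y) / 2) \<le> B" by simp
  qed
  have diff: "(\<integral>y. (norm (?A H y - ?A K y))\<^sup>2 \<partial>\<mu>) = 2 * q H + 2 * q K - 4 * mid H K" for H K
  proof -
    have "(norm (a - b))\<^sup>2 = 2 * (norm a)\<^sup>2 + 2 * (norm b)\<^sup>2 - 4 * (norm ((a + b) / 2))\<^sup>2" for a b :: complex
      by (simp only: cmod_power2) (simp add: power2_eq_square field_simps)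
    then have "(\<integral>y. (norm (?A H y - ?A K y))\<^sup>2 \<partial>\<mu>) =
        (\<integral>y. 2 * (norm (?A H y))\<^sup>2 + 2 * (norm (?A K y))\<^sup>2 - 4 * (norm ((?A H y + ?A K y) / 2))\<^sup>2 \<partial>\<mu>)"
      by simp
    also have "\<dots> = 2 * q H + 2 * q K - 4 * mid H K"
      unfolding q_def mid_def using int_A int_mid
      by (simp only: Bochner_Integration.integral_diff Bochner_Integration.integral_add
          integral_mult_right_zero Bochner_Integration.integrable_add integrable_mult_right)
    finally show ?thesis .
  qed
  \<comment> \<open>The parallelogram identity multiplies the excess over \<open>c\<close> by four,
    which the final division by 4 compensates.\<close>
  have "\<exists>L. \<forall>N\<ge>L. q N \<le> c + (1 / 4) ^ j / 4" for j :: nat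
    by (rule q_lim) simp
  then obtain L where L: "\<And>j N. N \<ge> L j \<Longrightarrow> q N \<le> c + (1 / 4) ^ j / 4" by metis
  \<comment> \<open>The partial sums dominate every earlier threshold, and \<open>Suc j\<close>
    makes \<open>s\<close> positive and strictly increasing.\<close>
  define s where "s j = Suc j + (\<Sum>i\<le>j. L i)" for j
  have s_pos: "s j > 0" for j by (simp add: s_def)
  have s_ge: "L j \<le> s j" "L j \<le> s (Suc j)" for j
    by (simp_all add: s_def sum.atMost_Suc_shift lessThan_Suc_atMost[symmetric])
  have fast: "(\<integral>y. (norm (?A (s (Suc j)) y - ?A (s j) y))\<^sup>2 \<partial>\<mu>) \<le> (1 / 4) ^ j" for j
    using diff[of "s (Suc j)" "s j"] L[OF s_ge(1), of j] L[OF s_ge(2), of j] mid_ge[OF s_pos s_pos, of "Suc j" j]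
    by linarith
  define h where "h y = lim (\<lambda>j. ?A (s j) y)" for y
  have "AE y in \<mu>. convergent (\<lambda>j. ?A (s j) y)"
    by (rule AE_convergent_if_L2_fast_Cauchy) (use prob_space_axioms meas int_diff fast in auto)
  then have lim_h: "AE y in \<mu>. (\<lambda>j. ?A (s j) y) \<longlonglongrightarrow> h y"
    by eventually_elim (simp add: h_def convergent_LIMSEQ_iff)
  have meas_h: "h \<in> borel_measurable \<mu>"
    unfolding h_def by (intro borel_measurable_lim_metric meas)
  have h_le: "AE y in \<mu>. norm (h y) \<le> B"
    using lim_h by eventually_elim (auto intro!: LIMSEQ_le_const2[OF tendsto_norm] A)
  \<comment> \<open>A vanishing limit would drive \<open>q (s j)\<close> to zero by dominated
    convergence, against the lower bound \<open>e\<close>.\<close>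
  have "\<not> (AE y in \<mu>. h y = 0)"
  proof
    assume "AE y in \<mu>. h y = 0"
    have "(\<lambda>j. q (s j)) \<longlonglongrightarrow> (\<integral>y. 0 \<partial>\<mu>)"
      unfolding q_def
    proof (rule integral_dominated_convergence[where w = "\<lambda>_. B\<^sup>2"])
      show "AE y in \<mu>. (\<lambda>j. (norm (?A (s j) y))\<^sup>2) \<longlonglongrightarrow> 0"
        using lim_h \<open>AE y in \<mu>. h y = 0\<close>
      proof eventually_elim
        case (elim y)
        then show ?case using tendsto_power[OF tendsto_norm[OF elim(1)], of 2] by simp
      qed
      show "AE y in \<mu>. norm ((norm (?A (s j) y))\<^sup>2) \<le> B\<^sup>2" for j
        using A by (simp add: power_mono)
    qed (use meas in auto)
    then have "e \<le> 0"
      by (intro LIMSEQ_le_const[of "\<lambda>j. q (s j)"]) (auto intro: qe s_pos)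
    then show False using e by simp
  qed
  moreover have "AE y in \<mu>. h (T y) = cis (- (2 * pi * \<beta>)) * h y"
  proof -
    have distr: "T \<in> measurable \<mu> \<mu>" "distr \<mu> \<mu> T = \<mu>"
      using inv by (simp_all add: invariant_prob_def)
    \<comment> \<open>Invariance carries the almost sure convergence at \<open>y\<close> over to
      \<open>T y\<close>.\<close>
    have "AE y in distr \<mu> \<mu> T. (\<lambda>j. ?A (s j) y) \<longlonglongrightarrow> h y"
      unfolding distr(2) by (rule lim_h)
    then have "AE y in \<mu>. (\<lambda>j. ?A (s j) (T y)) \<longlonglongrightarrow> h (T y)"
      by (rule AE_distrD[OF distr(1)])
    with lim_h show ?thesis
    proof eventually_elim
      case (elim y)
      have "(\<lambda>j. 2 * B / real (s j)) \<longlonglongrightarrow> 0"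
      proof (rule LIMSEQ_subseq_LIMSEQ[OF small, unfolded o_def])
        show "strict_mono s" by (rule strict_monoI_Suc) (simp add: s_def)
      qed
      then have "(\<lambda>j. cis (2 * pi * \<beta>) * ?A (s j) (T y) - ?A (s j) y) \<longlonglongrightarrow> 0"
        by (rule Lim_null_comparison[rotated])
           (intro always_eventually allI twisted_average_equivariant f s_pos)
      moreover have "(\<lambda>j. cis (2 * pi * \<beta>) * ?A (s j) (T y) - ?A (s j) y) \<longlonglongrightarrow> cis (2 * pi * \<beta>) * h (T y) - h y"
        by (intro tendsto_intros elim)
      ultimately have "cis (2 * pi * \<beta>) * h (T y) = h y"
        using LIMSEQ_unique by fastforce
      then show ?case
        by (metis (no_types, opaque_lifting) ab_group_add_class.ab_left_minus cis_mult cis_zero mult.assoc mult_1)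
    qed
  qed
  ultimately have "cis (- (2 * pi * \<beta>)) \<in> E0 T \<mu>"
    unfolding E0_def using meas_h int[OF meas_h h_le] by blast
  then show False using noeig by simp
qed

section \<open>Polynomial phases\<close>

text \<open>For a window length with small mean square, the squared modulus of the window average is
  a continuous function. Its orbit averages converge from every starting point, and they dominate
  the long twisted averages up to a boundary term.\<close>

lemma twisted_average_tendsto_0:
  fixes T :: "'a::metric_space \<Rightarrow> 'a" and f :: "'a \<Rightarrow> complex"
  assumes tds: "tds T" and ue: "uniquely_ergodic T \<mu>"
    and f: "continuous_on UNIV f" and noeig: "cis (- (2 * pi * \<beta>)) \<notin> E0 T \<mu>"
  shows "(\<lambda>N. twisted_average T f \<beta> N x) \<longlonglongrightarrow> 0"
proof (rule tendstoI)
  fix e :: real assume e: "e > 0"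
  have comp: "compact (UNIV :: 'a set)" and T: "continuous_on UNIV T"
    using tds by (simp_all add: tds_def)
  have inv: "invariant_prob T \<mu>" using ue by (simp add: uniquely_ergodic_def)
  have "bounded (range f)"
    by (intro compact_imp_bounded compact_continuous_image f comp)
  then obtain B where B: "\<And>y. norm (f y) \<le> B" by (auto simp: bounded_iff)
  let ?A = "twisted_average T f \<beta>"
  obtain H where H: "H > 0" "(\<integral>y. (norm (?A H y))\<^sup>2 \<partial>\<mu>) < e\<^sup>2"
    using twisted_mean_ergodic[OF inv T f B noeig, of "e\<^sup>2"] e by auto
  have cont: "continuous_on UNIV (\<lambda>y. (norm (?A H y))\<^sup>2)"
    by (intro continuous_intros continuous_on_twisted_average T f)
  have "(\<lambda>N. (\<Sum>n<N. (norm (?A H ((T ^^ n) x)))\<^sup>2) / real N + 4 * B\<^sup>2 * real H / real N)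
      \<longlonglongrightarrow> (\<integral>y. (norm (?A H y))\<^sup>2 \<partial>\<mu>) + 0"
    by (intro tendsto_add uniquely_ergodic_average_tendsto_integral[OF tds ue cont] lim_const_over_n)
  then have "\<forall>\<^sub>F N in sequentially.
      (\<Sum>n<N. (norm (?A H ((T ^^ n) x)))\<^sup>2) / real N + 4 * B\<^sup>2 * real H / real N < e\<^sup>2"
    using H(2) by (intro order_tendstoD(2)) auto
  then show "\<forall>\<^sub>F N in sequentially. dist (?A N x) 0 < e"
    using eventually_gt_at_top[of 0]
  proof eventually_elim
    case (elim N)
    let ?u = "\<lambda>n. cis (2 * pi * real n * \<beta>) * f ((T ^^ n) x)"
    have u: "norm (?u n) \<le> B" for n using B by (simp add: norm_mult)
    from norm_average_square_window_le[of ?u B N H, OF u elim(2) H(1)]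
    have "(norm (?A N x))\<^sup>2
        \<le> (\<Sum>n<N. (norm (?A H ((T ^^ n) x)))\<^sup>2) / real N + 4 * B\<^sup>2 * real H / real N"
      by (simp only: twisted_average_shift norm_mult norm_cis mult_1_left twisted_average_def[symmetric])
    then have "(norm (?A N x))\<^sup>2 < e\<^sup>2" using elim(1) by linarith
    then show ?case using e by (simp add: power2_less_imp_less)
  qed
qed

section \<open>Polynomial differencing\<close>

lemma pcompose_shift_coeff:
  fixes Q :: "real poly"
  assumes "degree Q \<le> Suc d"
  shows "coeff (pcompose Q [:c, 1:]) (Suc d) = coeff Q (Suc d)"
    and "coeff (pcompose Q [:c, 1:]) d = coeff Q d + real (Suc d) * c * coeff Q (Suc d)"
proof -
  have eq: "coeff (pcompose Q [:c, 1:]) i = (\<Sum>j\<le>Suc d. coeff Q j * coeff ([:c, 1:] ^ j) i)" for i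
  proof -
    have "pcompose Q [:c, 1:] = (\<Sum>j\<le>Suc d. smult (coeff Q j) ([:c, 1:] ^ j))"
    proof (subst poly_as_sum_of_monoms'[OF assms, symmetric], subst pcompose_sum, intro sum.cong refl)
      fix j show "pcompose (monom (coeff Q j) j) [:c, 1:] = smult (coeff Q j) ([:c, 1:] ^ j)"
        by (simp add: poly_eq_poly_eq_iff[symmetric] fun_eq_iff poly_pcompose poly_monom)
    qed
    then show ?thesis by (simp add: coeff_sum)
  qed
  have z: "coeff ([:c, 1:] ^ j) i = 0" if "j < i" for i j
    by (rule coeff_eq_0) (simp add: degree_linear_power that)
  show "coeff (pcompose Q [:c, 1:]) (Suc d) = coeff Q (Suc d)"
    unfolding eq by (simp add: z coeff_linear_power sum.neutral)
  have "(\<Sum>j<d. coeff Q j * coeff ([:c, 1:] ^ j) d) = 0"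
    by (simp add: z)
  moreover have "coeff ([:c, 1:] ^ Suc d) d = real (Suc d) * c"
    by (subst coeff_linear_poly_power) (simp_all del: power_Suc)
  ultimately show "coeff (pcompose Q [:c, 1:]) d = coeff Q d + real (Suc d) * c * coeff Q (Suc d)"
    unfolding eq by (simp add: lessThan_Suc_atMost[symmetric] coeff_linear_power del: power_Suc)
qed

text \<open>The leading coefficients cancel. What matters later is that the next one depends only on
  \<open>a - b\<close> and the leading coefficient of \<open>Q\<close>, so lower coefficients cannot
  affect the induction.\<close>

lemma pcompose_shift_diff:
  fixes Q :: "real poly"
  fixes a b :: real
  assumes "degree Q \<le> Suc d"
  defines "R \<equiv> pcompose Q [:a, 1:] - pcompose Q [:b, 1:]"
  shows "degree R \<le> d" and "coeff R d = real (Suc d) * (a - b) * coeff Q (Suc d)"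
proof -
  have "degree (pcompose Q [:c, 1:]) \<le> Suc d" for c
    using degree_pcompose_le[of Q "[:c, 1:]"] assms(1) by simp
  then have "degree R \<le> Suc d"
    unfolding R_def by (intro degree_diff_le)
  moreover have "coeff R (Suc d) = 0"
    unfolding R_def using pcompose_shift_coeff(1)[OF assms(1)] by simp
  ultimately show "degree R \<le> d"
    by (metis eq_zero_or_degree_less less_Suc_eq_le degree_0 zero_le)
  show "coeff R d = real (Suc d) * (a - b) * coeff Q (Suc d)"
    unfolding R_def using pcompose_shift_coeff(2)[OF assms(1)] by (simp add: algebra_simps)
qed

text \<open>The quantifier over \<open>Q\<close> stands inside the eventuality, so one threshold for
  \<open>N\<close> serves all lower coefficients. The induction varies \<open>f\<close>,
  \<open>\<beta>\<close> and \<open>e\<close>, since differencing replaces all three.\<close>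

lemma polynomial_phase_average_small:
  fixes T :: "'a::metric_space \<Rightarrow> 'a" and f :: "'a \<Rightarrow> complex"
  assumes tds: "tds T" and ue: "uniquely_ergodic T \<mu>"
    and "continuous_on UNIV f"
    and "\<And>m::int. m \<noteq> 0 \<Longrightarrow> cis (2 * pi * (of_int m * \<beta>)) \<notin> E0 T \<mu>" and "e > 0"
  shows "\<forall>\<^sub>F N in sequentially. \<forall>Q. degree Q \<le> Suc j \<longrightarrow> coeff Q (Suc j) = \<beta> \<longrightarrow>
    norm ((\<Sum>n<N. cis (2 * pi * poly Q (real n)) * f ((T ^^ n) x)) / of_nat N) \<le> e"
  using assms(3-5)
proof (induction j arbitrary: f \<beta> e)
  case 0
  have "cis (- (2 * pi * \<beta>)) \<notin> E0 T \<mu>" using "0.prems"(2)[of "-1"] by simp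
  then have "\<forall>\<^sub>F N in sequentially. dist (twisted_average T f \<beta> N x) 0 < e"
    by (intro tendstoD twisted_average_tendsto_0[OF tds ue] "0.prems")
  then show ?case
  proof (eventually_elim, intro allI impI)
    fix N and Q :: "real poly"
    assume N: "dist (twisted_average T f \<beta> N x) 0 < e" and Q: "degree Q \<le> Suc 0" "coeff Q (Suc 0) = \<beta>"
    \<comment> \<open>The constant term contributes only a factor of modulus one.\<close>
    define c where "c = coeff Q 0"
    have c: "poly Q t = c + t * \<beta>" for t
      unfolding c_def Q(2)[symmetric]
      by (subst poly_as_sum_of_monoms'[OF Q(1), symmetric]) (simp add: poly_sum poly_monom)
    have "cis (2 * pi * poly Q t) = cis (2 * pi * c) * cis (2 * pi * t * \<beta>)" for t
      by (simp add: c cis_mult ring_distribs mult.assoc)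
    then have "(\<Sum>n<N. cis (2 * pi * poly Q (real n)) * f ((T ^^ n) x)) / of_nat N
        = cis (2 * pi * c) * twisted_average T f \<beta> N x"
      by (simp add: twisted_average_def sum_distrib_left mult.assoc)
    then show "norm ((\<Sum>n<N. cis (2 * pi * poly Q (real n)) * f ((T ^^ n) x)) / of_nat N) \<le> e"
      using N by (simp add: norm_mult)
  qed
next
  case (Suc j)
  have comp: "compact (UNIV :: 'a set)" and T: "continuous_on UNIV T"
    using tds by (simp_all add: tds_def)
  have "bounded (range f)"
    by (intro compact_imp_bounded compact_continuous_image Suc.prems comp)
  then obtain B where B: "\<And>y. norm (f y) \<le> B" by (auto simp: bounded_iff)
  \<comment> \<open>Each of the three terms in van der Corput's bound receives a third of
    \<open>e\<^sup>2\<close>.\<close>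
  define \<delta> where "\<delta> = e\<^sup>2 / 3"
  have \<delta>: "\<delta> > 0" using Suc.prems(3) by (simp add: \<delta>_def)
  have "\<forall>\<^sub>F H in sequentially. B\<^sup>2 / real H < \<delta>"
    by (rule order_tendstoD(2)[OF lim_const_over_n \<delta>])
  then obtain H where H: "H > 0" "B\<^sup>2 / real H < \<delta>"
    using eventually_happens[OF eventually_conj[OF _ eventually_gt_at_top[of 0]]] by auto
  define F where "F h l y = f ((T ^^ h) y) * cnj (f ((T ^^ l) y))" for h l y
  have F: "continuous_on UNIV (F h l)" for h l
    unfolding F_def[abs_def]
    by (intro continuous_intros continuous_on_compose2[OF Suc.prems(1)] continuous_on_funpow T) auto
  \<comment> \<open>This is the leading coefficient after differencing by \<open>h\<close> and
    \<open>l\<close>, a nonzero integer multiple of \<open>\<beta>\<close> when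
    \<open>h \<noteq> l\<close>.\<close>
  define \<gamma> where "\<gamma> h l = real (Suc (Suc j)) * (real h - real l) * \<beta>" for h l :: nat
  have "\<forall>\<^sub>F N in sequentially. \<forall>R. degree R \<le> Suc j \<longrightarrow> coeff R (Suc j) = \<gamma> h l \<longrightarrow>
      norm ((\<Sum>n<N. cis (2 * pi * poly R (real n)) * F h l ((T ^^ n) x)) / of_nat N) \<le> \<delta>"
    if "h \<noteq> l" for h l
  proof (rule Suc.IH[OF F _ \<delta>])
    fix m :: int assume "m \<noteq> 0"
    then have "m * (int (Suc (Suc j)) * (int h - int l)) \<noteq> 0" using that by simp
    moreover have "of_int m * \<gamma> h l = of_int (m * (int (Suc (Suc j)) * (int h - int l))) * \<beta>"
      by (simp add: \<gamma>_def)
    ultimately show "cis (2 * pi * (of_int m * \<gamma> h l)) \<notin> E0 T \<mu>"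
      by (simp only:) (rule Suc.prems(2))
  qed
  \<comment> \<open>\<open>H\<close> is already fixed, so the finitely many pairs have a common
    threshold.\<close>
  then have "\<forall>\<^sub>F N in sequentially. \<forall>h\<in>{..<H}. \<forall>l\<in>{..<H}. h \<noteq> l \<longrightarrow>
      (\<forall>R. degree R \<le> Suc j \<longrightarrow> coeff R (Suc j) = \<gamma> h l \<longrightarrow>
        norm ((\<Sum>n<N. cis (2 * pi * poly R (real n)) * F h l ((T ^^ n) x)) / of_nat N) \<le> \<delta>)"
    by (intro eventually_ball_finite ballI finite_lessThan) auto
  moreover have "\<forall>\<^sub>F N in sequentially. 4 * B\<^sup>2 * real H / real N < \<delta>"
    by (rule order_tendstoD(2)[OF lim_const_over_n \<delta>])
  ultimately show ?case
    using eventually_gt_at_top[of 0]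
  proof (eventually_elim, intro allI impI)
    fix N and Q :: "real poly"
    assume corr: "\<forall>h\<in>{..<H}. \<forall>l\<in>{..<H}. h \<noteq> l \<longrightarrow>
      (\<forall>R. degree R \<le> Suc j \<longrightarrow> coeff R (Suc j) = \<gamma> h l \<longrightarrow>
        norm ((\<Sum>n<N. cis (2 * pi * poly R (real n)) * F h l ((T ^^ n) x)) / of_nat N) \<le> \<delta>)"
      and N: "4 * B\<^sup>2 * real H / real N < \<delta>" "0 < N"
      and Q: "degree Q \<le> Suc (Suc j)" "coeff Q (Suc (Suc j)) = \<beta>"
    define u where "u n = cis (2 * pi * poly Q (real n)) * f ((T ^^ n) x)" for n
    have "(norm ((\<Sum>n<N. u n) / of_nat N))\<^sup>2 \<le> B\<^sup>2 / real H + \<delta> + 4 * B\<^sup>2 * real H / real N"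
    proof (rule van_der_Corput_bound[OF _ N(2) H(1)])
      show "norm (u n) \<le> B" for n using B by (simp add: u_def norm_mult)
      show "0 \<le> \<delta>" using \<delta> by simp
      fix h l assume hl: "h < H" "l < H" "h \<noteq> l"
      define R where "R = pcompose Q [:real h, 1:] - pcompose Q [:real l, 1:]"
      have "degree R \<le> Suc j" "coeff R (Suc j) = \<gamma> h l"
        unfolding R_def \<gamma>_def using pcompose_shift_diff[OF Q(1)] Q(2) by simp_all
      moreover have "u (n + h) * cnj (u (n + l)) = cis (2 * pi * poly R (real n)) * F h l ((T ^^ n) x)" for n
      proof -
        have shift: "(T ^^ (n + i)) x = (T ^^ i) ((T ^^ n) x)" for i
          by (subst add.commute) (simp add: funpow_add)
        have "u (n + h) * cnj (u (n + l))
            = cis (2 * pi * poly Q (real (n + h))) * cis (- (2 * pi * poly Q (real (n + l)))) * F h l ((T ^^ n) x)"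
          by (simp add: u_def F_def shift cis_cnj mult_ac)
        also have "cis (2 * pi * poly Q (real (n + h))) * cis (- (2 * pi * poly Q (real (n + l))))
            = cis (2 * pi * poly R (real n))"
          by (simp add: cis_mult R_def poly_pcompose algebra_simps)
        finally show ?thesis .
      qed
      ultimately show "norm ((\<Sum>n<N. u (n + h) * cnj (u (n + l))) / of_nat N) \<le> \<delta>"
        using corr hl by simp
    qed
    also have "\<dots> \<le> e\<^sup>2" using H(2) N(1) unfolding \<delta>_def by linarith
    finally show "norm ((\<Sum>n<N. cis (2 * pi * poly Q (real n)) * f ((T ^^ n) x)) / of_nat N) \<le> e"
      unfolding u_def by (rule power2_le_imp_le) (use Suc.prems(3) in simp)
  qed
qed

theorem theorem4p2:
  fixes T :: "'a::metric_space \<Rightarrow> 'a" and \<mu> :: "'a measure"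
    and f :: "'a \<Rightarrow> complex" and \<alpha> :: real and k :: nat and x :: 'a
  assumes "tds T"
    and "uniquely_ergodic T \<mu>"
    and "E0 T \<mu> = G0 T"
    and "continuous_on UNIV f"
    and "0 \<le> \<alpha>" and "\<alpha> < 1" and "\<alpha> \<notin> D T \<mu>"
    and "k \<ge> 1"
  shows "(\<lambda>N::nat. SUP P\<in>{P :: real poly. degree P \<le> k - 1}.
            cmod ((\<Sum>n<N. cis (2 * pi * (real n ^ k * \<alpha> + poly P (real n))) * f ((T ^^ n) x))
                  / of_nat N)) \<longlonglongrightarrow> 0"
proof (rule LIMSEQ_I)
  fix e :: real assume e: "e > 0"
  let ?S = "{P :: real poly. degree P \<le> k - 1}"
  let ?g = "\<lambda>N P. cmod ((\<Sum>n<N. cis (2 * pi * (real n ^ k * \<alpha> + poly P (real n))) * f ((T ^^ n) x)) / of_nat N)"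
  obtain j where k: "k = Suc j" using assms(8) by (cases k) auto
  have noeig: "cis (2 * pi * (of_int m * \<alpha>)) \<notin> E0 T \<mu>" if "m \<noteq> 0" for m :: int
  proof -
    \<comment> \<open>Membership in \<open>D\<close> includes the bounds on \<open>\<alpha>\<close>;
      given them, \<open>\<alpha> \<notin> D T \<mu>\<close> excludes every such eigenvalue.\<close>
    have "exp (2 * pi * \<i> * of_int m * of_real \<alpha>) = cis (2 * pi * (of_int m * \<alpha>))"
      by (simp add: cis_conv_exp mult_ac)
    then show ?thesis using assms(5-7) that by (auto simp: D_def)
  qed
  \<comment> \<open>A supremum of values below a bound may attain it, so \<open>e / 2\<close>
    secures the strict inequality.\<close>
  have "\<forall>\<^sub>F N in sequentially. \<forall>Q. degree Q \<le> Suc j \<longrightarrow> coeff Q (Suc j) = \<alpha> \<longrightarrow>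
    norm ((\<Sum>n<N. cis (2 * pi * poly Q (real n)) * f ((T ^^ n) x)) / of_nat N) \<le> e / 2"
    by (rule polynomial_phase_average_small[OF assms(1,2,4) noeig]) (use e in auto)
  then obtain N0 where N0: "\<And>N Q. N \<ge> N0 \<Longrightarrow> degree Q \<le> Suc j \<Longrightarrow> coeff Q (Suc j) = \<alpha> \<Longrightarrow>
    norm ((\<Sum>n<N. cis (2 * pi * poly Q (real n)) * f ((T ^^ n) x)) / of_nat N) \<le> e / 2"
    by (auto simp: eventually_sequentially)
  have bound: "?g N P \<le> e / 2" if "N \<ge> N0" "P \<in> ?S" for N P
  proof -
    have "degree (monom \<alpha> k + P) \<le> Suc j"
      using that(2) k degree_monom_le[of \<alpha> k] by (intro degree_add_le) auto
    moreover have "coeff (monom \<alpha> k + P) (Suc j) = \<alpha>"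
      using that(2) k by (simp add: coeff_eq_0)
    ultimately show ?thesis
      using N0[OF that(1), of "monom \<alpha> k + P"] by (simp add: poly_monom mult.commute)
  qed
  \<comment> \<open>The zero polynomial makes the index set nonempty and the supremum
    nonnegative.\<close>
  have zero: "(0 :: real poly) \<in> ?S" by simp
  show "\<exists>N0. \<forall>N\<ge>N0. norm ((SUP P\<in>?S. ?g N P) - 0) < e"
  proof (intro exI[of _ N0] allI impI)
    fix N assume N: "N \<ge> N0"
    have "(SUP P\<in>?S. ?g N P) \<le> e / 2"
    proof (rule cSUP_least)
      show "?S \<noteq> {}" using zero by blast
    qed (rule bound[OF N])
    moreover have "?g N 0 \<le> (SUP P\<in>?S. ?g N P)"
      using bound[OF N] by (intro cSUP_upper[OF zero] bdd_aboveI2[of _ _ "e / 2"]) auto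
    moreover have "0 \<le> ?g N 0" by (rule norm_ge_zero)
    ultimately show "norm ((SUP P\<in>?S. ?g N P) - 0) < e"
      using e by (simp only: real_norm_def diff_zero)
  qed
qed

end
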